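(* Let $p$ be a prime, $n\ge 1$ an integer, and let $F$ be a finite field of characteristic $p$ with $q=p^n$ elements. Let $U(FC_{32})$ be the unit group of the group algebra $FC_{32}$. (1) If $p=2$, then $$U(FC_{32})\cong C_{32}^{n}\times C_{16}^{n}\times C_{8}^{2n}\times C_{4}^{4n}\times C_{2}^{8n}\times C_{2^n-1}.$$ (2) If $p\neq 2$, then $U(FC_{32})$ is isomorphic to: - $C_{p^n-1}^{32}$, if $q\equiv 1 \pmod{32}$; - $C_{p^n-1}^{2}\times C_{p^{2n}-1}^{15}$, if $q\equiv -1\pmod{32}$; - $C_{p^{8n}-1}^{2}\times C_{p^{4n}-1}^{2}\times C_{p^{2n}-1}^{3}\times C_{p^n-1}^{2}$, if $q\equiv 3,\,-5,\,11$ or $-13\pmod{32}$; - $C_{p^{8n}-1}^{2}\times C_{p^{4n}-1}^{2}\times C_{p^{2n}-1}^{2}\times C_{p^n-1}^{4}$, if $q\equiv -3,\,5,\,-11$ or $13\pmod{32}$; - $C_{p^n-1}^{2}\times C_{p^{4n}-1}^{4}\times C_{p^{2n}-1}^{7}$, if $q\equiv 7\pmod{32}$; - $C_{p^n-1}^{8}\times C_{p^{2n}-1}^{4}\times C_{p^{4n}-1}^{4}$, if $q\equiv -7\pmod{32}$; - $C_{p^n-1}^{2}\times C_{p^{2n}-1}^{15}$, if $q\equiv 15\pmod{32}$; - $C_{p^n-1}^{16}\times C_{p^{2n}-1}^{8}$, if $q\equiv -15\pmod{32}$.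
   Context: $C_m$ denotes the cyclic group of order $m$, and $C_m^k$ denotes the direct product of $k$ copies of $C_m$. For a group $G$ and a field $F$, $FG$ is the group algebra and $U(FG)$ is the multiplicative group of all its invertible elements. *)

theory Defs
  imports "HOL-Algebra.Algebra" "HOL-Number_Theory.Cong"
begin

definition ring_characteristic :: "('a, 'm) ring_scheme \<Rightarrow> nat" where
  "ring_characteristic R =
    (if \<exists>k::nat. k > 0 \<and> [k] \<cdot>\<^bsub>R\<^esub> \<one>\<^bsub>R\<^esub> = \<zero>\<^bsub>R\<^esub>
     then LEAST k::nat. k > 0 \<and> [k] \<cdot>\<^bsub>R\<^esub> \<one>\<^bsub>R\<^esub> = \<zero>\<^bsub>R\<^esub> else 0)"

(* The formal sum of the f g * g over g in G is represented by its coefficient function f, of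
   finite support and undefined outside the carrier of G.  In the convolution the sum over all g
   is restricted to the support of f, because finsum is only meaningful on finite index sets. *)
definition group_algebra ::
  "('a, 'm) ring_scheme \<Rightarrow> ('g, 'n) monoid_scheme \<Rightarrow> ('g \<Rightarrow> 'a) ring" where
  "group_algebra R G =
    \<lparr>carrier = {f \<in> carrier G \<rightarrow>\<^sub>E carrier R. finite {g \<in> carrier G. f g \<noteq> \<zero>\<^bsub>R\<^esub>}},
     monoid.mult = (\<lambda>f h. \<lambda>x\<in>carrier G.
       \<Oplus>\<^bsub>R\<^esub> g\<in>{g \<in> carrier G. f g \<noteq> \<zero>\<^bsub>R\<^esub>}. f g \<otimes>\<^bsub>R\<^esub> h (inv\<^bsub>G\<^esub> g \<otimes>\<^bsub>G\<^esub> x)),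
     one = (\<lambda>x\<in>carrier G. if x = \<one>\<^bsub>G\<^esub> then \<one>\<^bsub>R\<^esub> else \<zero>\<^bsub>R\<^esub>),
     ring.zero = (\<lambda>x\<in>carrier G. \<zero>\<^bsub>R\<^esub>),
     ring.add = (\<lambda>f h. \<lambda>x\<in>carrier G. f x \<oplus>\<^bsub>R\<^esub> h x)\<rparr>"

abbreviation cyclic_power :: "nat \<Rightarrow> nat \<Rightarrow> (nat \<Rightarrow> int) monoid" where
  "cyclic_power m k \<equiv> product_group {..<k} (\<lambda>_. integer_mod_group m)"

end

theory Submission
  imports Defs
begin

text \<open>
  In characteristic 2 the element \<open>y = X + 1\<close> is nilpotent, \<open>y ^ 32 = 0\<close>, and every element of the
  algebra is a constant plus a multiple of \<open>y\<close>. Let \<open>b\<^sub>1, \<dots>, b\<^sub>n\<close> generate the additive group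
  of \<open>F\<close>. Since \<open>(1 + b y ^ j) ^ (2 ^ k) = 1 + b ^ (2 ^ k) y ^ (j 2 ^ k)\<close>, the elements
  \<open>1 + b\<^sub>i y ^ j\<close> with \<open>j\<close> odd, together with a generator of the multiplicative group of \<open>F\<close>, generate
  all units: one corrects the leading term of a unit \<open>1 + a y ^ m + \<dots>\<close>, by downward induction on
  \<open>m\<close>. The orders of these generators multiply up to the number of units, so they form a basis.

  In odd characteristic, three quadratic extensions lead from \<open>F\<close> with \<open>q\<close> elements to a field \<open>K\<close>
  with \<open>q ^ 8\<close> elements, and \<open>32\<close> divides \<open>q ^ 8 - 1\<close>, so \<open>K\<close> contains a primitive 32nd root of unity
  \<open>\<zeta>\<close>. The Fourier coefficients \<open>f(\<zeta> ^ r)\<close> satisfy \<open>f(\<zeta> ^ r) ^ q = f(\<zeta> ^ (q r))\<close>, so they are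
  determined by one representative \<open>r\<close> of each orbit of multiplication by \<open>q\<close> on the residues modulo 32,
  and for an orbit of length \<open>d\<close> the coefficient lies in the subfield of order \<open>q ^ d\<close>. Fourier
  inversion and counting show that the algebra is the product of these subfields.
\<close>

section \<open>Products of cyclic groups\<close>

text \<open>Neither half proves independence of generators or surjectivity of a transform directly:
  one half of a bijection is shown, and a count of elements supplies the other. In characteristic 2
  the orders are therefore the crucial data. The least power of two carrying \<open>j\<close> to at
  least 32 is 32, 16, 8, 4 and 2 for \<open>j = 1\<close>, \<open>j = 3\<close>,
  \<open>j = 5, 7\<close>, \<open>j = 9, ..., 15\<close> and \<open>j = 17, ..., 31\<close>, which
  explains the exponents \<open>n, n, 2n, 4n, 8n\<close>. In odd characteristic the obstacle is that
  \<open>X ^ 32 - 1\<close> factors over \<open>F\<close> in a way that depends on the residue of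
  \<open>q\<close>. A single field \<open>K\<close> that is large enough in all cases makes the
  argument uniform: only the list of orbits varies, and that list is checked by computation.
  Quadratic steps are chosen because a nonsquare always exists, so that \<open>K\<close> can be
  written down with pairs instead of an irreducible polynomial of degree 8.\<close>

lemma product_group_cong:
  assumes "\<And>i. i \<in> I \<Longrightarrow> G i = H i"
  shows "product_group I G = product_group I H"
proof (rule monoid.equality)
  show "carrier (product_group I G) = carrier (product_group I H)"
    using assms by (auto simp: PiE_def Pi_def)
  show "monoid.mult (product_group I G) = monoid.mult (product_group I H)"
    using assms by (auto simp: fun_eq_iff)
  show "one (product_group I G) = one (product_group I H)"
    using assms by (auto simp: fun_eq_iff)
qed simp

lemma product_group_split:
  fixes G :: "nat \<Rightarrow> ('a, 'b) monoid_scheme"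
  shows "product_group {..<a + b} G
     \<cong> product_group {..<a} G \<times>\<times> product_group {..<b} (\<lambda>i. G (a + i))"
proof (rule is_isoI)
  let ?h = "\<lambda>f. (restrict f {..<a}, \<lambda>i\<in>{..<b}. f (a + i))"
  let ?k = "\<lambda>(f, g). \<lambda>i\<in>{..<a + b}. if i < a then f i else g (i - a)"
  show "?h \<in> iso (product_group {..<a + b} G)
      (product_group {..<a} G \<times>\<times> product_group {..<b} (\<lambda>i. G (a + i)))"
  proof (rule isoI)
    show "?h \<in> hom (product_group {..<a + b} G)
        (product_group {..<a} G \<times>\<times> product_group {..<b} (\<lambda>i. G (a + i)))"
    proof (rule homI)
      fix f g assume "f \<in> carrier (product_group {..<a + b} G)"
      then show "?h f \<in> carrier (product_group {..<a} G \<times>\<times> product_group {..<b} (\<lambda>i. G (a + i)))"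
        by (simp add: PiE_iff)
      show "?h (f \<otimes>\<^bsub>product_group {..<a + b} G\<^esub> g) = ?h f
          \<otimes>\<^bsub>product_group {..<a} G \<times>\<times> product_group {..<b} (\<lambda>i. G (a + i))\<^esub> ?h g"
        by (simp add: restrict_def fun_eq_iff)
    qed
    show "bij_betw ?h (carrier (product_group {..<a + b} G))
        (carrier (product_group {..<a} G \<times>\<times> product_group {..<b} (\<lambda>i. G (a + i))))"
    proof (rule bij_betw_byWitness[where f' = ?k]; safe)
      fix f assume f: "f \<in> carrier (product_group {..<a + b} G)"
      show "(\<lambda>i\<in>{..<a + b}. if i < a then restrict f {..<a} i
          else (\<lambda>i\<in>{..<b}. f (a + i)) (i - a)) = f"
        using f by (intro extensionalityI[of _ "{..<a + b}"]) (auto simp: PiE_iff)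
      show "(restrict f {..<a}, \<lambda>i\<in>{..<b}. f (a + i)) \<in> carrier (product_group {..<a} G
          \<times>\<times> product_group {..<b} (\<lambda>i. G (a + i)))"
        using f by (auto simp: PiE_iff)
    next
      fix f g assume "(f, g) \<in> carrier (product_group {..<a} G \<times>\<times> product_group {..<b} (\<lambda>i. G (a + i)))"
      then have f: "f \<in> (\<Pi>\<^sub>E i\<in>{..<a}. carrier (G i))"
        and g: "g \<in> (\<Pi>\<^sub>E i\<in>{..<b}. carrier (G (a + i)))"
        by auto
      let ?fg = "\<lambda>i\<in>{..<a + b}. if i < a then f i else g (i - a)"
      show "restrict ?fg {..<a} = f"
        using f by (intro extensionalityI[of _ "{..<a}"]) (auto simp: PiE_iff)
      show "(\<lambda>i\<in>{..<b}. ?fg (a + i)) = g"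
        using g by (intro extensionalityI[of _ "{..<b}"]) (auto simp: PiE_iff)
      have "g (i - a) \<in> carrier (G i)" if "a \<le> i" "i < a + b" for i
        using PiE_mem[OF g, of "i - a"] that by simp
      then show "?fg \<in> carrier (product_group {..<a + b} G)"
        using f by (auto simp: PiE_iff)
    qed
  qed
qed

lemma product_group_singleton: "product_group {i} G \<cong> G i"
proof (rule is_isoI, rule isoI)
  show "(\<lambda>f. f i) \<in> hom (product_group {i} G) (G i)"
    by (rule homI) auto
  show "bij_betw (\<lambda>f. f i) (carrier (product_group {i} G)) (carrier (G i))"
    by (rule bij_betw_byWitness[where f' = "\<lambda>x. \<lambda>j\<in>{i}. x"])
      (auto simp: fun_eq_iff PiE_def Pi_def extensional_def)
qed

text \<open>Peels one block of equal factors off the front of a product. The rest \<open>K\<close>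
  enters through a premise, so repeated application builds the right-nested products of the
  theorem.\<close>

lemma cyclic_power_split:
  assumes "\<And>i. i < a \<Longrightarrow> m i = c"
    and "product_group {..<b} (\<lambda>i. integer_mod_group (m (a + i))) \<cong> K"
  shows "product_group {..<a + b} (\<lambda>i. integer_mod_group (m i)) \<cong> cyclic_power c a \<times>\<times> K"
proof -
  have eq: "product_group {..<a} (\<lambda>i. integer_mod_group (m i)) = cyclic_power c a"
    using assms(1) by (intro product_group_cong) auto
  obtain h where h: "h \<in> iso (product_group {..<b} (\<lambda>i. integer_mod_group (m (a + i)))) K"
    using assms(2) unfolding is_iso_def by blast
  have "cyclic_power c a \<times>\<times> product_group {..<b} (\<lambda>i. integer_mod_group (m (a + i)))
      \<cong> cyclic_power c a \<times>\<times> K"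
    by (rule is_isoI[OF group.DirProd_iso_set_trans[OF _ iso_set_refl h]]) simp
  with product_group_split[of a b "\<lambda>i. integer_mod_group (m i)"] show ?thesis
    unfolding eq by (rule iso_trans)
qed

section \<open>Unit groups of products and of isomorphic structures\<close>

lemma units_of_product_group:
  "units_of (product_group I G) = product_group I (\<lambda>i. units_of (G i))"
proof (rule monoid.equality)
  show "carrier (units_of (product_group I G)) = carrier (product_group I (\<lambda>i. units_of (G i)))"
  proof (intro equalityI subsetI)
    fix x assume "x \<in> carrier (units_of (product_group I G))"
    then obtain y where x: "x \<in> carrier (product_group I G)" and y: "y \<in> carrier (product_group I G)"
      and xy: "y \<otimes>\<^bsub>product_group I G\<^esub> x = \<one>\<^bsub>product_group I G\<^esub>"
        "x \<otimes>\<^bsub>product_group I G\<^esub> y = \<one>\<^bsub>product_group I G\<^esub>"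
      unfolding units_of_carrier Units_def by (elim CollectE conjE bexE)
    have "x i \<in> Units (G i)" if "i \<in> I" for i
    proof -
      have "y i \<otimes>\<^bsub>G i\<^esub> x i = \<one>\<^bsub>G i\<^esub>" "x i \<otimes>\<^bsub>G i\<^esub> y i = \<one>\<^bsub>G i\<^esub>"
        using fun_cong[OF xy(1), of i] fun_cong[OF xy(2), of i] that by simp_all
      moreover have "x i \<in> carrier (G i)" "y i \<in> carrier (G i)"
        using x y that by (auto simp: PiE_iff)
      ultimately show ?thesis unfolding Units_def by blast
    qed
    with x show "x \<in> carrier (product_group I (\<lambda>i. units_of (G i)))"
      by (auto simp: units_of_carrier PiE_iff)
  next
    fix x assume x: "x \<in> carrier (product_group I (\<lambda>i. units_of (G i)))"
    then have "\<forall>i\<in>I. \<exists>y. y \<in> carrier (G i) \<and> y \<otimes>\<^bsub>G i\<^esub> x i = \<one>\<^bsub>G i\<^esub> \<and> x i \<otimes>\<^bsub>G i\<^esub> y = \<one>\<^bsub>G i\<^esub>"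
      by (auto simp: units_of_carrier Units_def PiE_iff)
    then obtain y where "\<forall>i\<in>I. y i \<in> carrier (G i) \<and> y i \<otimes>\<^bsub>G i\<^esub> x i = \<one>\<^bsub>G i\<^esub> \<and> x i \<otimes>\<^bsub>G i\<^esub> y i = \<one>\<^bsub>G i\<^esub>"
      by metis
    with x show "x \<in> carrier (units_of (product_group I G))"
      by (auto simp: units_of_carrier Units_def PiE_iff fun_eq_iff
          intro!: bexI[of _ "restrict y I"])
  qed
qed (auto simp: units_of_def product_group_def fun_eq_iff)

text \<open>Multiplicative maps need not preserve the unit element, hence the premise
  \<open>one\<close>. A unit of \<open>N\<close> and its inverse have preimages, and injectivity
  carries the two equations for the inverse back to \<open>M\<close>.\<close>

lemma units_of_iso:
  assumes hom: "h \<in> hom M N" and bij: "bij_betw h (carrier M) (carrier N)"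
    and one: "h \<one>\<^bsub>M\<^esub> = \<one>\<^bsub>N\<^esub>" "\<one>\<^bsub>M\<^esub> \<in> carrier M"
    and closed: "\<And>x y. x \<in> carrier M \<Longrightarrow> y \<in> carrier M \<Longrightarrow> x \<otimes>\<^bsub>M\<^esub> y \<in> carrier M"
  shows "units_of M \<cong> units_of N"
proof (rule is_isoI, rule isoI)
  have inj: "x = y" if "x \<in> carrier M" "y \<in> carrier M" "h x = h y" for x y
    using bij that by (auto simp: bij_betw_def inj_on_def)
  have carr: "h x \<in> carrier N" if "x \<in> carrier M" for x
    using bij that by (auto simp: bij_betw_def)
  have mult: "h (x \<otimes>\<^bsub>M\<^esub> y) = h x \<otimes>\<^bsub>N\<^esub> h y" if "x \<in> carrier M" "y \<in> carrier M" for x y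
    using hom that by (simp add: hom_mult)
  have img: "h x \<in> Units N" if "x \<in> Units M" for x
  proof -
    obtain y where y: "x \<in> carrier M" "y \<in> carrier M" "y \<otimes>\<^bsub>M\<^esub> x = \<one>\<^bsub>M\<^esub>" "x \<otimes>\<^bsub>M\<^esub> y = \<one>\<^bsub>M\<^esub>"
      using \<open>x \<in> Units M\<close> by (auto simp: Units_def)
    then have "h y \<otimes>\<^bsub>N\<^esub> h x = \<one>\<^bsub>N\<^esub>" "h x \<otimes>\<^bsub>N\<^esub> h y = \<one>\<^bsub>N\<^esub>"
      using one(1) by (simp_all flip: mult)
    with y(1,2) show ?thesis by (auto simp: Units_def intro!: carr bexI[of _ "h y"])
  qed
  show "h \<in> hom (units_of M) (units_of N)"
  proof (rule homI)
    fix x y assume "x \<in> carrier (units_of M)" "y \<in> carrier (units_of M)"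
    then have "x \<in> carrier M" "y \<in> carrier M" by (auto simp: units_of_carrier Units_def)
    then show "h (x \<otimes>\<^bsub>units_of M\<^esub> y) = h x \<otimes>\<^bsub>units_of N\<^esub> h y"
      by (simp add: units_of_mult mult)
  qed (simp add: units_of_carrier img)
  show "bij_betw h (carrier (units_of M)) (carrier (units_of N))"
    unfolding bij_betw_def units_of_carrier
  proof
    show "inj_on h (Units M)" by (auto simp: inj_on_def Units_def intro: inj)
    show "h ` Units M = Units N"
    proof (intro equalityI subsetI)
      fix z assume "z \<in> Units N"
      then obtain w where w: "z \<in> carrier N" "w \<in> carrier N"
        "w \<otimes>\<^bsub>N\<^esub> z = \<one>\<^bsub>N\<^esub>" "z \<otimes>\<^bsub>N\<^esub> w = \<one>\<^bsub>N\<^esub>"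
        by (auto simp: Units_def)
      have "z \<in> h ` carrier M" "w \<in> h ` carrier M"
        using bij w(1,2) by (simp_all add: bij_betw_def)
      then obtain x y where xy: "x \<in> carrier M" "y \<in> carrier M" "h x = z" "h y = w"
        by (elim imageE) simp
      have "y \<otimes>\<^bsub>M\<^esub> x = \<one>\<^bsub>M\<^esub>" "x \<otimes>\<^bsub>M\<^esub> y = \<one>\<^bsub>M\<^esub>"
        using xy w one by (auto intro!: inj closed simp: mult)
      with xy have "x \<in> Units M" unfolding Units_def by blast
      with xy(3) show "z \<in> h ` Units M" by blast
    qed (auto intro: img)
  qed
qed

lemma (in monoid) pow_mod:
  assumes "x \<in> carrier G" "x [^] m = \<one>"
  shows "x [^] (k mod m) = x [^] (k::nat)"
proof -
  have "x [^] k = x [^] (m * (k div m) + k mod m)" by simp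
  also have "\<dots> = (x [^] m) [^] (k div m) \<otimes> x [^] (k mod m)"
    using assms(1) by (simp only: nat_pow_mult nat_pow_pow)
  finally show ?thesis using assms by simp
qed

text \<open>Surjectivity together with the bound on the order forces the obvious map to be injective.\<close>

lemma (in comm_group) iso_product_of_generators:
  fixes I :: "'i set"
  assumes fin: "finite (carrier G)" and I: "finite I"
    and e: "\<And>i. i \<in> I \<Longrightarrow> e i \<in> carrier G"
    and m: "\<And>i. i \<in> I \<Longrightarrow> m i > 0" and em: "\<And>i. i \<in> I \<Longrightarrow> e i [^] m i = \<one>"
    and gen: "generate G (e ` I) = carrier G"
    and card: "(\<Prod>i\<in>I. m i) \<le> card (carrier G)"
  shows "G \<cong> product_group I (\<lambda>i. integer_mod_group (m i))"
proof -
  let ?P = "product_group I (\<lambda>i. integer_mod_group (m i))"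
  define \<Psi> where "\<Psi> f = (\<Otimes>i\<in>I. e i [^] nat (f i))" for f :: "'i \<Rightarrow> int"
  have hom: "\<Psi> \<in> hom ?P G"
  proof (rule homI)
    show "\<Psi> f \<in> carrier G" for f
      unfolding \<Psi>_def using e by (intro finprod_closed) auto
    fix f g assume f: "f \<in> carrier ?P" and g: "g \<in> carrier ?P"
    have "e i [^] nat ((f i + g i) mod int (m i)) = e i [^] nat (f i) \<otimes> e i [^] nat (g i)"
      if "i \<in> I" for i
    proof -
      have "0 \<le> f i" "0 \<le> g i"
        using f g m[OF that] that by (auto simp: carrier_integer_mod_group PiE_iff)
      then have "nat ((f i + g i) mod int (m i)) = (nat (f i) + nat (g i)) mod m i"
        by (simp add: nat_mod_distrib nat_add_distrib)
      then show ?thesis using e[OF that] em[OF that] by (simp add: pow_mod nat_pow_mult)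
    qed
    then have "\<Psi> (f \<otimes>\<^bsub>?P\<^esub> g) = (\<Otimes>i\<in>I. e i [^] nat (f i) \<otimes> e i [^] nat (g i))"
      unfolding \<Psi>_def using e by (intro finprod_cong') auto
    then show "\<Psi> (f \<otimes>\<^bsub>?P\<^esub> g) = \<Psi> f \<otimes> \<Psi> g"
      unfolding \<Psi>_def using e by (simp add: finprod_multf)
  qed
  interpret P: group ?P by simp
  interpret h: group_hom ?P G \<Psi>
    using hom by (intro group_hom.intro group_hom_axioms.intro) (auto simp: P.is_group)
  have "e i \<in> \<Psi> ` carrier ?P" if i: "i \<in> I" for i
  proof
    \<comment> \<open>The unit vector at \<open>i\<close>; its entry is \<open>1 mod m i\<close>
      because a factor with \<open>m i = 1\<close> contains only 0.\<close>
    define f where "f = (\<lambda>j\<in>I. if j = i then 1 mod int (m i) else 0)"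
    show "f \<in> carrier ?P" using m by (auto simp: f_def carrier_integer_mod_group)
    have *: "e i [^] (1 mod m i) = e i"
      using pow_mod[OF e[OF i] em[OF i], of 1] e[OF i] by (simp add: nat_pow_eone)
    have "\<Psi> f = (\<Otimes>j\<in>I. if j = i then e j [^] (1 mod m j) else \<one>)"
      unfolding \<Psi>_def f_def using e
      by (intro finprod_cong') (auto simp flip: nat_mod_distrib simp: zmod_int[symmetric] nat_mod_distrib)
    also have "\<dots> = e i [^] (1 mod m i)"
      using e I i by (intro finprod_singleton_swap) auto
    finally show "e i = \<Psi> f" using * by simp
  qed
  then have "generate G (e ` I) \<subseteq> \<Psi> ` carrier ?P"
    by (intro generate_subgroup_incl h.img_is_subgroup) auto
  then have img: "\<Psi> ` carrier ?P = carrier G"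
    using gen h.hom_closed by blast
  have cm: "carrier (integer_mod_group (m i)) = {0..<int (m i)}" if "i \<in> I" for i
    using m[OF that] by (simp add: carrier_integer_mod_group)
  have cP: "card (carrier ?P) = (\<Prod>i\<in>I. m i)" "finite (carrier ?P)"
    using I cm by (auto simp: card_PiE intro!: finite_PiE)
  have "inj_on \<Psi> (carrier ?P)"
    using cP card card_image_le[OF cP(2), of \<Psi>] img by (intro eq_card_imp_inj_on) auto
  then have "?P \<cong> G"
    using hom img by (auto intro!: is_isoI isoI simp: bij_betw_def)
  then show ?thesis by (rule P.iso_sym)
qed

section \<open>Group algebras of finite commutative groups\<close>

lemma (in abelian_monoid) finsum_swap:
  assumes "finite A" "finite B" "\<And>x y. x \<in> A \<Longrightarrow> y \<in> B \<Longrightarrow> f x y \<in> carrier G"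
  shows "(\<Oplus>x\<in>A. \<Oplus>y\<in>B. f x y) = (\<Oplus>y\<in>B. \<Oplus>x\<in>A. f x y)"
  using assms(1,3)
proof (induction A rule: finite_induct)
  case empty
  then show ?case by simp
next
  case (insert a A)
  have *: "(\<lambda>y. f x y) \<in> B \<rightarrow> carrier G" if "x \<in> insert a A" for x
    using insert.prems that by auto
  have "(\<Oplus>x\<in>insert a A. \<Oplus>y\<in>B. f x y) = (\<Oplus>y\<in>B. f a y) \<oplus> (\<Oplus>x\<in>A. \<Oplus>y\<in>B. f x y)"
    using insert.hyps * by (intro finsum_insert) auto
  also have "\<dots> = (\<Oplus>y\<in>B. f a y) \<oplus> (\<Oplus>y\<in>B. \<Oplus>x\<in>A. f x y)"
    using insert by simp
  also have "\<dots> = (\<Oplus>y\<in>B. f a y \<oplus> (\<Oplus>x\<in>A. f x y))"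
    using * insert.prems by (intro finsum_addf[symmetric]) (auto intro!: finsum_closed)
  also have "\<dots> = (\<Oplus>y\<in>B. \<Oplus>x\<in>insert a A. f x y)"
    using insert.hyps insert.prems
    by (intro finsum_cong' refl) (auto intro!: finsum_closed finsum_insert[symmetric])
  finally show ?case .
qed

locale finite_group_algebra = R: cring R + G: comm_group G
  for R :: "('a, 'm) ring_scheme" (structure) and G :: "('g, 'n) monoid_scheme" (structure) +
  assumes finite_G: "finite (carrier G)"
begin

abbreviation "A \<equiv> group_algebra R G"

definition single :: "'a \<Rightarrow> 'g \<Rightarrow> 'g \<Rightarrow> 'a" where
  "single a g = (\<lambda>x\<in>carrier G. if x = g then a else \<zero>\<^bsub>R\<^esub>)"

lemma carrier_A: "carrier A = carrier G \<rightarrow>\<^sub>E carrier R"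
  using finite_G by (auto simp: group_algebra_def)

lemma one_A: "\<one>\<^bsub>A\<^esub> = single \<one>\<^bsub>R\<^esub> \<one>\<^bsub>G\<^esub>"
  by (simp add: group_algebra_def single_def)

lemma zero_A: "\<zero>\<^bsub>A\<^esub> = (\<lambda>x\<in>carrier G. \<zero>\<^bsub>R\<^esub>)"
  by (simp add: group_algebra_def)

lemma add_A: "f \<oplus>\<^bsub>A\<^esub> h = (\<lambda>x\<in>carrier G. f x \<oplus>\<^bsub>R\<^esub> h x)"
  by (simp add: group_algebra_def)

lemma coeff_closed: "f \<in> carrier A \<Longrightarrow> x \<in> carrier G \<Longrightarrow> f x \<in> carrier R"
  by (auto simp: carrier_A)

lemma A_eqI:
  assumes "f \<in> carrier A" "h \<in> carrier A" "\<And>x. x \<in> carrier G \<Longrightarrow> f x = h x"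
  shows "f = h"
  using assms by (auto simp: carrier_A intro: PiE_ext)

lemma single_closed: "a \<in> carrier R \<Longrightarrow> single a g \<in> carrier A"
  by (auto simp: carrier_A single_def)

text \<open>The terms outside the support of \<open>f\<close> are zero. Summing over all of
  \<open>G\<close> frees the index set from \<open>f\<close>, as the substitutions below
  require.\<close>

lemma mult_A:
  assumes "f \<in> carrier A" "h \<in> carrier A"
  shows "f \<otimes>\<^bsub>A\<^esub> h =
    (\<lambda>x\<in>carrier G. \<Oplus>\<^bsub>R\<^esub> g\<in>carrier G. f g \<otimes>\<^bsub>R\<^esub> h (inv\<^bsub>G\<^esub> g \<otimes>\<^bsub>G\<^esub> x))"
proof -
  have "(\<Oplus>\<^bsub>R\<^esub> g\<in>{g \<in> carrier G. f g \<noteq> \<zero>\<^bsub>R\<^esub>}. f g \<otimes>\<^bsub>R\<^esub> h (inv\<^bsub>G\<^esub> g \<otimes>\<^bsub>G\<^esub> x))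
      = (\<Oplus>\<^bsub>R\<^esub> g\<in>carrier G. f g \<otimes>\<^bsub>R\<^esub> h (inv\<^bsub>G\<^esub> g \<otimes>\<^bsub>G\<^esub> x))" if "x \<in> carrier G" for x
    using that finite_G assms by (intro R.add.finprod_mono_neutral_cong_left) (auto simp: coeff_closed)
  then show ?thesis by (auto simp: group_algebra_def)
qed

lemma mult_closed:
  assumes "f \<in> carrier A" "h \<in> carrier A"
  shows "f \<otimes>\<^bsub>A\<^esub> h \<in> carrier A"
  unfolding mult_A[OF assms] carrier_A
  using coeff_closed[OF assms(1)] coeff_closed[OF assms(2)]
  by (intro restrict_PiE_iff[THEN iffD2] ballI R.finsum_closed) auto

text \<open>A multiplicative \<open>\<chi>\<close> extends linearly to a multiplicative map on the
  algebra. The trivial \<open>\<chi>\<close> gives the augmentation, the powers of a root of unity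
  give the Fourier coefficients.\<close>

lemma character_sum_mult:
  assumes "cring S" and \<iota>: "\<iota> \<in> ring_hom R S"
    and \<chi>: "\<And>g. g \<in> carrier G \<Longrightarrow> \<chi> g \<in> carrier S"
      "\<And>g x. g \<in> carrier G \<Longrightarrow> x \<in> carrier G \<Longrightarrow> \<chi> (g \<otimes>\<^bsub>G\<^esub> x) = \<chi> g \<otimes>\<^bsub>S\<^esub> \<chi> x"
    and f: "f \<in> carrier A" and h: "h \<in> carrier A"
  shows "(\<Oplus>\<^bsub>S\<^esub>x\<in>carrier G. \<iota> ((f \<otimes>\<^bsub>A\<^esub> h) x) \<otimes>\<^bsub>S\<^esub> \<chi> x)
    = (\<Oplus>\<^bsub>S\<^esub>x\<in>carrier G. \<iota> (f x) \<otimes>\<^bsub>S\<^esub> \<chi> x) \<otimes>\<^bsub>S\<^esub> (\<Oplus>\<^bsub>S\<^esub>x\<in>carrier G. \<iota> (h x) \<otimes>\<^bsub>S\<^esub> \<chi> x)"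
proof -
  interpret S: cring S by fact
  interpret \<iota>: ring_hom_cring R S \<iota>
    using \<iota> by unfold_locales
  have c: "f x \<in> carrier R" "h x \<in> carrier R" if "x \<in> carrier G" for x
    using that f h coeff_closed by auto
  have "(\<Oplus>\<^bsub>S\<^esub>x\<in>carrier G. \<iota> ((f \<otimes>\<^bsub>A\<^esub> h) x) \<otimes>\<^bsub>S\<^esub> \<chi> x)
      = (\<Oplus>\<^bsub>S\<^esub>x\<in>carrier G. \<Oplus>\<^bsub>S\<^esub>g\<in>carrier G. \<iota> (f g) \<otimes>\<^bsub>S\<^esub> \<iota> (h (inv\<^bsub>G\<^esub> g \<otimes>\<^bsub>G\<^esub> x)) \<otimes>\<^bsub>S\<^esub> \<chi> x)"
  proof (intro S.finsum_cong' refl)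
    fix x assume x: "x \<in> carrier G"
    have "\<iota> ((f \<otimes>\<^bsub>A\<^esub> h) x) = (\<Oplus>\<^bsub>S\<^esub>g\<in>carrier G. \<iota> (f g) \<otimes>\<^bsub>S\<^esub> \<iota> (h (inv\<^bsub>G\<^esub> g \<otimes>\<^bsub>G\<^esub> x)))"
      using x c by (simp add: mult_A[OF f h] o_def) (intro S.finsum_cong' refl, auto)
    then show "\<iota> ((f \<otimes>\<^bsub>A\<^esub> h) x) \<otimes>\<^bsub>S\<^esub> \<chi> x
        = (\<Oplus>\<^bsub>S\<^esub>g\<in>carrier G. \<iota> (f g) \<otimes>\<^bsub>S\<^esub> \<iota> (h (inv\<^bsub>G\<^esub> g \<otimes>\<^bsub>G\<^esub> x)) \<otimes>\<^bsub>S\<^esub> \<chi> x)"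
      using x c \<chi> finite_G by (simp add: S.finsum_ldistr)
  qed (use c \<chi> in \<open>auto intro!: S.finsum_closed\<close>)
  also have "\<dots> = (\<Oplus>\<^bsub>S\<^esub>g\<in>carrier G. \<Oplus>\<^bsub>S\<^esub>x\<in>carrier G. \<iota> (f g) \<otimes>\<^bsub>S\<^esub> \<iota> (h (inv\<^bsub>G\<^esub> g \<otimes>\<^bsub>G\<^esub> x)) \<otimes>\<^bsub>S\<^esub> \<chi> x)"
    using c \<chi> finite_G by (intro S.finsum_swap) auto
  also have "\<dots> = (\<Oplus>\<^bsub>S\<^esub>g\<in>carrier G. \<iota> (f g) \<otimes>\<^bsub>S\<^esub> \<chi> g \<otimes>\<^bsub>S\<^esub> (\<Oplus>\<^bsub>S\<^esub>x\<in>carrier G. \<iota> (h x) \<otimes>\<^bsub>S\<^esub> \<chi> x))"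
  proof (intro S.finsum_cong' refl)
    fix g assume g: "g \<in> carrier G"
    \<comment> \<open>Left multiplication by \<open>g\<close> permutes \<open>G\<close>; after this
      substitution the inverse of \<open>g\<close> cancels and \<open>\<chi>\<close> splits off the
      factor \<open>\<chi> g\<close>.\<close>
    let ?u = "\<lambda>x. \<iota> (f g) \<otimes>\<^bsub>S\<^esub> \<iota> (h (inv\<^bsub>G\<^esub> g \<otimes>\<^bsub>G\<^esub> x)) \<otimes>\<^bsub>S\<^esub> \<chi> x"
    have "(\<Oplus>\<^bsub>S\<^esub>x\<in>carrier G. ?u x) = (\<Oplus>\<^bsub>S\<^esub>x\<in>(\<lambda>x. g \<otimes>\<^bsub>G\<^esub> x) ` carrier G. ?u x)"
      using g by (simp add: G.surj_const_mult)
    also have "\<dots> = (\<Oplus>\<^bsub>S\<^esub>x\<in>carrier G. ?u (g \<otimes>\<^bsub>G\<^esub> x))"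
      using g c \<chi> by (intro S.finsum_reindex) (auto intro: G.inj_on_cmult)
    also have "\<dots> = (\<Oplus>\<^bsub>S\<^esub>x\<in>carrier G. \<iota> (f g) \<otimes>\<^bsub>S\<^esub> \<chi> g \<otimes>\<^bsub>S\<^esub> (\<iota> (h x) \<otimes>\<^bsub>S\<^esub> \<chi> x))"
      using g c \<chi> by (intro S.finsum_cong' refl)
        (auto simp: G.m_assoc[symmetric] S.m_ac)
    also have "\<dots> = \<iota> (f g) \<otimes>\<^bsub>S\<^esub> \<chi> g \<otimes>\<^bsub>S\<^esub> (\<Oplus>\<^bsub>S\<^esub>x\<in>carrier G. \<iota> (h x) \<otimes>\<^bsub>S\<^esub> \<chi> x)"
      using g c \<chi> finite_G by (intro S.finsum_rdistr[symmetric]) auto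
    finally show "(\<Oplus>\<^bsub>S\<^esub>x\<in>carrier G. ?u x)
        = \<iota> (f g) \<otimes>\<^bsub>S\<^esub> \<chi> g \<otimes>\<^bsub>S\<^esub> (\<Oplus>\<^bsub>S\<^esub>x\<in>carrier G. \<iota> (h x) \<otimes>\<^bsub>S\<^esub> \<chi> x)" .
  qed (use c \<chi> in \<open>auto intro!: S.finsum_closed\<close>)
  also have "\<dots> = (\<Oplus>\<^bsub>S\<^esub>x\<in>carrier G. \<iota> (f x) \<otimes>\<^bsub>S\<^esub> \<chi> x) \<otimes>\<^bsub>S\<^esub> (\<Oplus>\<^bsub>S\<^esub>x\<in>carrier G. \<iota> (h x) \<otimes>\<^bsub>S\<^esub> \<chi> x)"
    using c \<chi> finite_G by (intro S.finsum_ldistr[symmetric]) (auto intro!: S.finsum_closed)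
  finally show ?thesis .
qed

section \<open>Ring structure of the group algebra\<close>

lemma single_mult:
  assumes a: "a \<in> carrier R" and g: "g \<in> carrier G" and h: "h \<in> carrier A"
  shows "single a g \<otimes>\<^bsub>A\<^esub> h = (\<lambda>x\<in>carrier G. a \<otimes>\<^bsub>R\<^esub> h (inv\<^bsub>G\<^esub> g \<otimes>\<^bsub>G\<^esub> x))"
proof (rule restrict_ext[THEN trans[OF mult_A[OF single_closed[OF a] h]]])
  fix x assume x: "x \<in> carrier G"
  have "(\<Oplus>\<^bsub>R\<^esub>k\<in>carrier G. single a g k \<otimes>\<^bsub>R\<^esub> h (inv\<^bsub>G\<^esub> k \<otimes>\<^bsub>G\<^esub> x))
      = (\<Oplus>\<^bsub>R\<^esub>k\<in>carrier G. if k = g then a \<otimes>\<^bsub>R\<^esub> h (inv\<^bsub>G\<^esub> k \<otimes>\<^bsub>G\<^esub> x) else \<zero>\<^bsub>R\<^esub>)"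
    using x a h by (intro R.finsum_cong' refl) (auto simp: single_def coeff_closed)
  also have "\<dots> = a \<otimes>\<^bsub>R\<^esub> h (inv\<^bsub>G\<^esub> g \<otimes>\<^bsub>G\<^esub> x)"
    using x a g h finite_G by (intro R.add.finprod_singleton_swap) (auto simp: coeff_closed)
  finally show "(\<Oplus>\<^bsub>R\<^esub>k\<in>carrier G. single a g k \<otimes>\<^bsub>R\<^esub> h (inv\<^bsub>G\<^esub> k \<otimes>\<^bsub>G\<^esub> x))
      = a \<otimes>\<^bsub>R\<^esub> h (inv\<^bsub>G\<^esub> g \<otimes>\<^bsub>G\<^esub> x)" .
qed

lemma single_mult_single:
  assumes "a \<in> carrier R" "b \<in> carrier R" "g \<in> carrier G" "h \<in> carrier G"
  shows "single a g \<otimes>\<^bsub>A\<^esub> single b h = single (a \<otimes>\<^bsub>R\<^esub> b) (g \<otimes>\<^bsub>G\<^esub> h)"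
proof -
  have "inv\<^bsub>G\<^esub> g \<otimes>\<^bsub>G\<^esub> x = h \<longleftrightarrow> x = g \<otimes>\<^bsub>G\<^esub> h" if "x \<in> carrier G" for x
    using G.inv_solve_left'[of h g x] assms that by auto
  moreover have "inv\<^bsub>G\<^esub> g \<otimes>\<^bsub>G\<^esub> x \<in> carrier G" if "x \<in> carrier G" for x
    using assms that by simp
  ultimately show ?thesis
    using assms(1,2) unfolding single_mult[OF assms(1,3) single_closed[OF assms(2)]]
    unfolding single_def by (intro restrict_ext) simp
qed

lemma mult_comm:
  assumes f: "f \<in> carrier A" and h: "h \<in> carrier A"
  shows "f \<otimes>\<^bsub>A\<^esub> h = h \<otimes>\<^bsub>A\<^esub> f"
proof (rule A_eqI)
  fix x assume x: "x \<in> carrier G"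
  \<comment> \<open>The involution sending \<open>g\<close> to the inverse of \<open>g\<close> times
    \<open>x\<close> exchanges the two arguments of the convolution at \<open>x\<close>.\<close>
  let ?k = "\<lambda>g. inv\<^bsub>G\<^esub> g \<otimes>\<^bsub>G\<^esub> x"
  have k: "?k (?k g) = g" if "g \<in> carrier G" for g
    using that x by (simp add: G.inv_mult_group G.m_assoc G.m_lcomm[of _ g])
  then have inj: "inj_on ?k (carrier G)" by (rule inj_on_inverseI)
  have "g \<in> ?k ` carrier G" if "g \<in> carrier G" for g
    using k[OF that] that x by (intro image_eqI[of _ _ "?k g"]) simp_all
  then have img: "?k ` carrier G = carrier G" using x by auto
  have "(f \<otimes>\<^bsub>A\<^esub> h) x = (\<Oplus>\<^bsub>R\<^esub>g\<in>?k ` carrier G. f g \<otimes>\<^bsub>R\<^esub> h (?k g))"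
    using x by (simp add: mult_A f h img)
  also have "\<dots> = (\<Oplus>\<^bsub>R\<^esub>g\<in>carrier G. f (?k g) \<otimes>\<^bsub>R\<^esub> h (?k (?k g)))"
    using x inj f h by (intro R.finsum_reindex) (auto simp: coeff_closed)
  also have "\<dots> = (\<Oplus>\<^bsub>R\<^esub>g\<in>carrier G. h g \<otimes>\<^bsub>R\<^esub> f (?k g))"
    using x k f h by (intro R.finsum_cong' refl) (auto simp: coeff_closed R.m_comm)
  finally show "(f \<otimes>\<^bsub>A\<^esub> h) x = (h \<otimes>\<^bsub>A\<^esub> f) x"
    using x by (simp add: mult_A f h)
qed (use f h mult_closed in auto)

lemma mult_assoc:
  assumes f: "f \<in> carrier A" and h: "h \<in> carrier A" and k: "k \<in> carrier A"
  shows "f \<otimes>\<^bsub>A\<^esub> h \<otimes>\<^bsub>A\<^esub> k = f \<otimes>\<^bsub>A\<^esub> (h \<otimes>\<^bsub>A\<^esub> k)"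
proof (rule A_eqI)
  fix x assume x: "x \<in> carrier G"
  note c = coeff_closed[OF f] coeff_closed[OF h] coeff_closed[OF k]
  have "(f \<otimes>\<^bsub>A\<^esub> h \<otimes>\<^bsub>A\<^esub> k) x = (\<Oplus>\<^bsub>R\<^esub>g\<in>carrier G. (f \<otimes>\<^bsub>A\<^esub> h) g \<otimes>\<^bsub>R\<^esub> k (inv\<^bsub>G\<^esub> g \<otimes>\<^bsub>G\<^esub> x))"
    using x by (simp add: mult_A[OF mult_closed[OF f h] k])
  also have "\<dots> = (\<Oplus>\<^bsub>R\<^esub>g\<in>carrier G. \<Oplus>\<^bsub>R\<^esub>a\<in>carrier G.
      f a \<otimes>\<^bsub>R\<^esub> h (inv\<^bsub>G\<^esub> a \<otimes>\<^bsub>G\<^esub> g) \<otimes>\<^bsub>R\<^esub> k (inv\<^bsub>G\<^esub> g \<otimes>\<^bsub>G\<^esub> x))"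
    using x c finite_G
    by (intro R.finsum_cong' refl) (auto simp: mult_A[OF f h] R.finsum_ldistr intro!: R.finsum_closed)
  also have "\<dots> = (\<Oplus>\<^bsub>R\<^esub>a\<in>carrier G. \<Oplus>\<^bsub>R\<^esub>g\<in>carrier G.
      f a \<otimes>\<^bsub>R\<^esub> h (inv\<^bsub>G\<^esub> a \<otimes>\<^bsub>G\<^esub> g) \<otimes>\<^bsub>R\<^esub> k (inv\<^bsub>G\<^esub> g \<otimes>\<^bsub>G\<^esub> x))"
    using x c finite_G by (intro R.finsum_swap) auto
  also have "\<dots> = (\<Oplus>\<^bsub>R\<^esub>a\<in>carrier G. f a \<otimes>\<^bsub>R\<^esub> (h \<otimes>\<^bsub>A\<^esub> k) (inv\<^bsub>G\<^esub> a \<otimes>\<^bsub>G\<^esub> x))"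
  proof (intro R.finsum_cong' refl)
    fix a assume a: "a \<in> carrier G"
    \<comment> \<open>Replacing \<open>g\<close> by \<open>a\<close> times \<open>g\<close> removes
      \<open>a\<close> from the argument of \<open>h\<close>.\<close>
    let ?u = "\<lambda>g. f a \<otimes>\<^bsub>R\<^esub> h (inv\<^bsub>G\<^esub> a \<otimes>\<^bsub>G\<^esub> g) \<otimes>\<^bsub>R\<^esub> k (inv\<^bsub>G\<^esub> g \<otimes>\<^bsub>G\<^esub> x)"
    have "(\<Oplus>\<^bsub>R\<^esub>g\<in>carrier G. ?u g) = (\<Oplus>\<^bsub>R\<^esub>g\<in>(\<lambda>g. a \<otimes>\<^bsub>G\<^esub> g) ` carrier G. ?u g)"
      using a by (simp add: G.surj_const_mult)
    also have "\<dots> = (\<Oplus>\<^bsub>R\<^esub>g\<in>carrier G. ?u (a \<otimes>\<^bsub>G\<^esub> g))"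
      using a x c by (intro R.finsum_reindex) (auto intro: G.inj_on_cmult)
    also have "\<dots> = (\<Oplus>\<^bsub>R\<^esub>g\<in>carrier G. f a \<otimes>\<^bsub>R\<^esub> (h g \<otimes>\<^bsub>R\<^esub> k (inv\<^bsub>G\<^esub> g \<otimes>\<^bsub>G\<^esub> (inv\<^bsub>G\<^esub> a \<otimes>\<^bsub>G\<^esub> x))))"
      using a x c by (intro R.finsum_cong' refl)
        (auto simp: G.m_assoc[symmetric] G.inv_mult_group R.m_assoc)
    also have "\<dots> = f a \<otimes>\<^bsub>R\<^esub> (h \<otimes>\<^bsub>A\<^esub> k) (inv\<^bsub>G\<^esub> a \<otimes>\<^bsub>G\<^esub> x)"
      using a x c finite_G by (auto simp: mult_A[OF h k] intro!: R.finsum_rdistr[symmetric])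
    finally show "(\<Oplus>\<^bsub>R\<^esub>g\<in>carrier G. ?u g) = f a \<otimes>\<^bsub>R\<^esub> (h \<otimes>\<^bsub>A\<^esub> k) (inv\<^bsub>G\<^esub> a \<otimes>\<^bsub>G\<^esub> x)" .
  qed (use x c coeff_closed[OF mult_closed[OF h k]] in auto)
  also have "\<dots> = (f \<otimes>\<^bsub>A\<^esub> (h \<otimes>\<^bsub>A\<^esub> k)) x"
    using x by (simp add: mult_A[OF f mult_closed[OF h k]])
  finally show "(f \<otimes>\<^bsub>A\<^esub> h \<otimes>\<^bsub>A\<^esub> k) x = (f \<otimes>\<^bsub>A\<^esub> (h \<otimes>\<^bsub>A\<^esub> k)) x" .
qed (use f h k mult_closed in auto)

lemma one_mult:
  assumes "f \<in> carrier A"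
  shows "\<one>\<^bsub>A\<^esub> \<otimes>\<^bsub>A\<^esub> f = f"
proof (rule A_eqI)
  show "\<one>\<^bsub>A\<^esub> \<otimes>\<^bsub>A\<^esub> f \<in> carrier A"
    using assms by (simp add: one_A single_closed mult_closed)
  show "(\<one>\<^bsub>A\<^esub> \<otimes>\<^bsub>A\<^esub> f) x = f x" if "x \<in> carrier G" for x
    using assms that by (simp add: one_A single_mult coeff_closed)
qed (use assms in auto)

sublocale A: cring A
proof (rule cringI)
  show "abelian_group A"
  proof (rule abelian_groupI)
    fix f assume f: "f \<in> carrier A"
    then have "(\<lambda>x\<in>carrier G. \<ominus>\<^bsub>R\<^esub> f x) \<in> carrier A"
      by (auto simp: carrier_A)
    moreover have "(\<lambda>x\<in>carrier G. \<ominus>\<^bsub>R\<^esub> f x) \<oplus>\<^bsub>A\<^esub> f = \<zero>\<^bsub>A\<^esub>"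
      using coeff_closed[OF f] by (auto simp: add_A zero_A R.l_neg)
    ultimately show "\<exists>g\<in>carrier A. g \<oplus>\<^bsub>A\<^esub> f = \<zero>\<^bsub>A\<^esub>" by blast
  next
    fix f assume f: "f \<in> carrier A"
    show "\<zero>\<^bsub>A\<^esub> \<oplus>\<^bsub>A\<^esub> f = f"
      using f coeff_closed[OF f] by (intro A_eqI) (auto simp: add_A zero_A carrier_A)
  next
    fix f h assume f: "f \<in> carrier A" "h \<in> carrier A"
    show "f \<oplus>\<^bsub>A\<^esub> h \<in> carrier A" "f \<oplus>\<^bsub>A\<^esub> h = h \<oplus>\<^bsub>A\<^esub> f"
      using coeff_closed[OF f(1)] coeff_closed[OF f(2)]
      by (auto simp: add_A R.a_comm intro!: restrict_ext) (simp add: carrier_A)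
    fix k assume k: "k \<in> carrier A"
    show "f \<oplus>\<^bsub>A\<^esub> h \<oplus>\<^bsub>A\<^esub> k = f \<oplus>\<^bsub>A\<^esub> (h \<oplus>\<^bsub>A\<^esub> k)"
      using f k by (auto simp: add_A coeff_closed R.a_assoc intro!: restrict_ext)
  qed (auto simp: zero_A carrier_A)
  show "comm_monoid A"
    by (rule comm_monoidI) (rule mult_closed mult_assoc one_mult mult_comm | simp add: one_A single_closed)+
  fix f h k assume fhk: "f \<in> carrier A" "h \<in> carrier A" "k \<in> carrier A"
  then have s: "f \<oplus>\<^bsub>A\<^esub> h \<in> carrier A" by (auto simp: add_A carrier_A)
  show "(f \<oplus>\<^bsub>A\<^esub> h) \<otimes>\<^bsub>A\<^esub> k = f \<otimes>\<^bsub>A\<^esub> k \<oplus>\<^bsub>A\<^esub> h \<otimes>\<^bsub>A\<^esub> k"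
  proof -
    have "(\<Oplus>\<^bsub>R\<^esub>g\<in>carrier G. (f \<oplus>\<^bsub>A\<^esub> h) g \<otimes>\<^bsub>R\<^esub> k (inv\<^bsub>G\<^esub> g \<otimes>\<^bsub>G\<^esub> x))
      = (\<Oplus>\<^bsub>R\<^esub>g\<in>carrier G. f g \<otimes>\<^bsub>R\<^esub> k (inv\<^bsub>G\<^esub> g \<otimes>\<^bsub>G\<^esub> x))
        \<oplus>\<^bsub>R\<^esub> (\<Oplus>\<^bsub>R\<^esub>g\<in>carrier G. h g \<otimes>\<^bsub>R\<^esub> k (inv\<^bsub>G\<^esub> g \<otimes>\<^bsub>G\<^esub> x))"
      if x: "x \<in> carrier G" for x
    proof -
      have "(\<Oplus>\<^bsub>R\<^esub>g\<in>carrier G. (f \<oplus>\<^bsub>A\<^esub> h) g \<otimes>\<^bsub>R\<^esub> k (inv\<^bsub>G\<^esub> g \<otimes>\<^bsub>G\<^esub> x))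
        = (\<Oplus>\<^bsub>R\<^esub>g\<in>carrier G. f g \<otimes>\<^bsub>R\<^esub> k (inv\<^bsub>G\<^esub> g \<otimes>\<^bsub>G\<^esub> x) \<oplus>\<^bsub>R\<^esub> h g \<otimes>\<^bsub>R\<^esub> k (inv\<^bsub>G\<^esub> g \<otimes>\<^bsub>G\<^esub> x))"
        using fhk x by (intro R.finsum_cong' refl) (auto simp: add_A coeff_closed R.l_distr)
      also have "\<dots> = (\<Oplus>\<^bsub>R\<^esub>g\<in>carrier G. f g \<otimes>\<^bsub>R\<^esub> k (inv\<^bsub>G\<^esub> g \<otimes>\<^bsub>G\<^esub> x))
        \<oplus>\<^bsub>R\<^esub> (\<Oplus>\<^bsub>R\<^esub>g\<in>carrier G. h g \<otimes>\<^bsub>R\<^esub> k (inv\<^bsub>G\<^esub> g \<otimes>\<^bsub>G\<^esub> x))"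
        using fhk x by (intro R.finsum_addf) (auto simp: coeff_closed)
      finally show ?thesis .
    qed
    then show ?thesis
      unfolding mult_A[OF s fhk(3)] mult_A[OF fhk(1,3)] mult_A[OF fhk(2,3)] add_A[of "restrict _ _"]
      by (intro restrict_ext) simp
  qed
qed

end

section \<open>Frobenius endomorphism and generators\<close>

lemma (in cring) binomial:
  assumes x: "x \<in> carrier R" and y: "y \<in> carrier R"
  shows "(x \<oplus> y) [^] n = (\<Oplus>k\<in>{..n}. [(n choose k)] \<cdot> (x [^] k \<otimes> y [^] (n - k)))"
proof (induction n)
  case 0
  then show ?case by simp
next
  case (Suc n)
  let ?S = "\<Oplus>k\<in>{..n}. [(n choose k)] \<cdot> (x [^] k \<otimes> y [^] (n - k))"
  \<comment> \<open>Pascal's rule: \<open>d\<close> collects the terms multiplied by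
    \<open>x\<close>, \<open>c\<close> those multiplied by \<open>y\<close>, and
    \<open>f (Suc k)\<close> is the sum of \<open>d k\<close> and \<open>c (Suc k)\<close>. Since
    \<open>c (Suc n)\<close> vanishes, the sum of \<open>c\<close> may be extended to
    \<open>Suc n\<close>.\<close>
  define c where "c k = [(n choose k)] \<cdot> (x [^] k \<otimes> y [^] (Suc n - k))" for k
  define d where "d k = [(n choose k)] \<cdot> (x [^] Suc k \<otimes> y [^] (n - k))" for k
  define f where "f k = [(Suc n choose k)] \<cdot> (x [^] k \<otimes> y [^] (Suc n - k))" for k
  have cl [simp]: "c k \<in> carrier R" "d k \<in> carrier R" "f k \<in> carrier R" for k
    using x y by (simp_all add: c_def d_def f_def)
  have "?S \<otimes> x = (\<Oplus>k\<in>{..n}. d k)"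
  proof -
    have "?S \<otimes> x = (\<Oplus>k\<in>{..n}. [(n choose k)] \<cdot> (x [^] k \<otimes> y [^] (n - k)) \<otimes> x)"
      using x y by (intro finsum_ldistr) auto
    also have "\<dots> = (\<Oplus>k\<in>{..n}. d k)"
      using x y by (intro finsum_cong' refl) (simp_all add: d_def add_pow_ldistr add_pow_rdistr m_ac)
    finally show ?thesis .
  qed
  moreover have "?S \<otimes> y = (\<Oplus>k\<in>{..n}. c k)"
  proof -
    have "?S \<otimes> y = (\<Oplus>k\<in>{..n}. [(n choose k)] \<cdot> (x [^] k \<otimes> y [^] (n - k)) \<otimes> y)"
      using x y by (intro finsum_ldistr) auto
    also have "\<dots> = (\<Oplus>k\<in>{..n}. c k)"
      using x y by (intro finsum_cong' refl) (simp_all add: c_def add_pow_ldistr m_assoc Suc_diff_le)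
    finally show ?thesis .
  qed
  moreover have "(\<Oplus>k\<in>{..Suc n}. f k) = (\<Oplus>k\<in>{..n}. d k) \<oplus> (\<Oplus>k\<in>{..n}. c k)"
  proof -
    have c_zero: "c (Suc n) = \<zero>" by (simp add: c_def binomial_eq_0)
    have "f (Suc k) = d k \<oplus> c (Suc k)" for k
      using x y by (simp add: f_def c_def d_def add.nat_pow_mult)
    moreover have "f 0 = c 0" by (simp add: f_def c_def)
    ultimately have "(\<Oplus>k\<in>{..Suc n}. f k) = (\<Oplus>k\<in>{..n}. d k \<oplus> c (Suc k)) \<oplus> c 0"
      by (subst finsum_Suc2) auto
    also have "\<dots> = (\<Oplus>k\<in>{..n}. d k) \<oplus> ((\<Oplus>k\<in>{..n}. c (Suc k)) \<oplus> c 0)"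
      by (simp add: finsum_addf a_assoc)
    also have "(\<Oplus>k\<in>{..n}. c (Suc k)) \<oplus> c 0 = (\<Oplus>k\<in>{..Suc n}. c k)"
      by (rule finsum_Suc2[symmetric]) auto
    also have "\<dots> = (\<Oplus>k\<in>{..n}. c k)"
      by (simp add: c_zero)
    finally show ?thesis .
  qed
  ultimately show ?case
    using x y Suc by (simp add: r_distr f_def)
qed

section \<open>Frobenius powers in prime characteristic\<close>

lemma (in cring) add_pow_eq_zero:
  fixes p m :: nat
  assumes "[p] \<cdot> \<one> = \<zero>" "p dvd m" "x \<in> carrier R"
  shows "[m] \<cdot> x = \<zero>"
proof -
  obtain c where "m = p * c" using assms(2) by (auto simp: dvd_def)
  then have "[m] \<cdot> \<one> = \<zero>"
    using assms(1) add.nat_pow_pow[of \<one> c p] by (simp add: mult.commute)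
  then show ?thesis
    using assms(3) add_pow_ldistr[of \<one> x m] by simp
qed

lemma (in cring) frobenius_add:
  fixes p :: nat
  assumes p: "Factorial_Ring.prime p" "[p] \<cdot> \<one> = \<zero>" and x: "x \<in> carrier R" and y: "y \<in> carrier R"
  shows "(x \<oplus> y) [^] p = x [^] p \<oplus> y [^] p"
proof -
  obtain m where m: "p = Suc m" using p(1) by (metis not0_implies_Suc not_prime_0)
  have "m > 0" using p(1) m by (cases m) auto
  define f where "f k = [(p choose k)] \<cdot> (x [^] k \<otimes> y [^] (p - k))" for k
  have [simp]: "f k \<in> carrier R" for k using x y by (simp add: f_def)
  have "(\<Oplus>k\<in>{..m}. f k) = (\<Oplus>k\<in>{..m}. if k = 0 then y [^] p else \<zero>)"
  proof (intro finsum_cong' refl)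
    fix k assume "k \<in> {..m}"
    then have "k \<noteq> 0 \<Longrightarrow> p dvd p choose k"
      using m p(1) by (intro dvd_choose_prime) auto
    then show "f k = (if k = 0 then y [^] p else \<zero>)"
      using x y p(2) by (auto simp: f_def add_pow_eq_zero)
  qed (use y in auto)
  also have "\<dots> = y [^] p"
    using y by (intro add.finprod_singleton_swap[of 0 "{..m}" "\<lambda>_. y [^] p"]) auto
  finally have "(\<Oplus>k\<in>{..p}. f k) = x [^] p \<oplus> y [^] p"
    using x y by (simp add: m) (simp add: f_def m)
  then show ?thesis using binomial[OF x y, of p] by (simp add: f_def)
qed

lemma (in cring) frobenius_power_add:
  fixes p :: nat
  assumes p: "Factorial_Ring.prime p" "[p] \<cdot> \<one> = \<zero>" and x: "x \<in> carrier R" and y: "y \<in> carrier R"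
  shows "(x \<oplus> y) [^] (p ^ k) = x [^] (p ^ k) \<oplus> y [^] (p ^ k)"
proof (induction k)
  case 0
  then show ?case using x y by (simp add: nat_pow_eone)
next
  case (Suc k)
  have *: "z [^] (p ^ Suc k) = (z [^] (p ^ k)) [^] p" if "z \<in> carrier R" for z
    using that by (simp add: nat_pow_pow mult.commute)
  show ?case
    unfolding *[OF add.m_closed[OF x y]] *[OF x] *[OF y] Suc
    using x y by (intro frobenius_add p) auto
qed

text \<open>By Lagrange, an element outside a subgroup enlarges it at least twofold, so
  \<open>n\<close> elements generate a group of order at most \<open>2 ^ n\<close>. For the additive
  group of \<open>F\<close> this takes the place of a basis over the prime field.\<close>

lemma (in group) generated_by_log2_order:
  assumes "finite (carrier G)" "card (carrier G) \<le> 2 ^ n"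
  shows "\<exists>b. (\<forall>i<n. b i \<in> carrier G) \<and> generate G (b ` {..<n}) = carrier G"
proof -
  have "\<exists>b. (\<forall>i<k. b i \<in> carrier G) \<and>
      (generate G (b ` {..<k}) = carrier G \<or> 2 ^ k \<le> card (generate G (b ` {..<k})))" for k
  proof (induction k)
    case 0
    then show ?case by (auto simp: generate_empty)
  next
    case (Suc k)
    then obtain b where b: "\<forall>i<k. b i \<in> carrier G"
      "generate G (b ` {..<k}) = carrier G \<or> 2 ^ k \<le> card (generate G (b ` {..<k}))" by blast
    let ?H = "generate G (b ` {..<k})"
    have H: "subgroup ?H G" using b(1) by (intro generate_is_subgroup) auto
    then have HG: "?H \<subseteq> carrier G" by (rule subgroup.subset)
    \<comment> \<open>Once everything is generated, any element may serve as the next generator;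
      this keeps the number of generators fixed.\<close>
    obtain c where c: "c \<in> carrier G" "?H \<noteq> carrier G \<Longrightarrow> c \<notin> ?H"
      using HG one_closed by blast
    let ?b = "b(k := c)"
    have "?b ` {..<Suc k} = insert c (b ` {..<k})"
      by (auto simp: lessThan_Suc)
    moreover have cl: "\<forall>i<Suc k. ?b i \<in> carrier G" using b(1) c(1) by (simp add: less_Suc_eq)
    moreover define H' where "H' = generate G (?b ` {..<Suc k})"
    ultimately have H': "subgroup H' G" "?H \<subseteq> H'" "c \<in> H'"
      using b(1) c(1) by (auto intro!: generate_is_subgroup mono_generate simp: H'_def intro: generate.incl)
    have "H' = carrier G \<or> 2 ^ Suc k \<le> card H'"
    proof (cases "?H = carrier G")
      case True
      then show ?thesis using H' subgroup.subset by blast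
    next
      case False
      have fin: "finite H'" using assms(1) H'(1) subgroup.subset finite_subset by metis
      have "card ?H < card H'"
        using H' c(2)[OF False] fin by (intro psubset_card_mono) auto
      moreover have "card ?H dvd card H'"
        using group.lagrange[OF subgroup_imp_group[OF H'(1)] subgroup_incl[OF H H'(1,2)]]
        by (metis dvd_triv_right order_def partial_object.select_convs(1) partial_object.update_convs(1) partial_object.surjective)
      ultimately have "2 * card ?H \<le> card H'"
        by (elim dvdE) (auto simp: mult_le_cancel1 split: if_splits)
      then show ?thesis using b(2) False by auto
    qed
    then show ?case using cl unfolding H'_def by blast
  qed
  then obtain b where b: "\<forall>i<n. b i \<in> carrier G"
    "generate G (b ` {..<n}) = carrier G \<or> 2 ^ n \<le> card (generate G (b ` {..<n}))" by blast
  have "generate G (b ` {..<n}) \<subseteq> carrier G"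
    using b(1) by (intro generate_incl) auto
  with assms b show ?thesis by (meson card_subset_eq card_mono le_antisym order_trans)
qed

lemma (in domain) nat_pow_nonzero:
  "x \<in> carrier R \<Longrightarrow> x \<noteq> \<zero> \<Longrightarrow> x [^] (k::nat) \<noteq> \<zero>"
  by (induction k) (simp_all add: integral_iff)

lemma (in field) finite_field_generator:
  assumes "finite (carrier R)"
  obtains g where "g \<in> carrier R" "g \<noteq> \<zero>"
    "\<And>x. x \<in> carrier R \<Longrightarrow> x \<noteq> \<zero> \<Longrightarrow> \<exists>i::nat. x = g [^] i"
  using finite_field_mult_group_has_gen[OF assms]
  unfolding Multiplicative_Group.carrier_mult_of
proof (elim bexE)
  fix a assume a: "a \<in> carrier R - {\<zero>}" "carrier R - {\<zero>} = {a [^] i | i::nat. i \<in> UNIV}"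
  then have "\<exists>i::nat. x = a [^] i" if "x \<in> carrier R" "x \<noteq> \<zero>" for x
    using that by blast
  then show ?thesis using a(1) by (intro that[of a]) auto
qed

lemma (in field) finite_field_power_card:
  assumes "finite (carrier R)" "x \<in> carrier R" "x \<noteq> \<zero>"
  shows "x [^] (card (carrier R) - 1) = \<one>"
  using group.pow_order_eq_1[OF field_mult_group, of x] order_mult_of[OF assms(1)] assms(2,3)
  by (simp add: Multiplicative_Group.nat_pow_mult_of order_def)

section \<open>Characteristic two\<close>

text \<open>An index below \<open>a * n\<close> encodes a block \<open>i div n\<close> and a
  position in it. The summand depends on the block only.\<close>

lemma sum_div_blocks: "(\<Sum>i<a * n. f (i div n)) = n * (\<Sum>t<a. f t)" for f :: "nat \<Rightarrow> nat"
proof (cases "n = 0")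
  case False
  have "(\<Sum>i<a * n. f (i div n)) = (\<Sum>t<a. \<Sum>i\<in>{t * n..<t * n + n}. f (i div n))"
    by (rule sum.nat_group[symmetric])
  also have "\<dots> = (\<Sum>t<a. \<Sum>i\<in>{t * n..<t * n + n}. f t)"
    using False by (intro sum.cong refl arg_cong[of _ _ f] div_nat_eqI) (auto simp: algebra_simps)
  finally show ?thesis by (simp add: sum_distrib_left)
qed simp

text \<open>An algebra \<open>R\<close> over a field \<open>F\<close> of order \<open>2 ^ n\<close> which is, like
  \<open>F[y]/(y ^ 32)\<close>, filtered by the powers of a nilpotent element \<open>y\<close>.\<close>

locale truncated_algebra = cring R + F: field F
  for R :: "('a, 'm) ring_scheme" (structure) and F :: "('b, 'k) ring_scheme" +
  fixes \<iota> :: "'b \<Rightarrow> 'a" and \<epsilon> :: "'a \<Rightarrow> 'b" and y :: 'a and n :: nat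
  assumes iota: "\<iota> \<in> ring_hom F R" and epsilon: "\<epsilon> \<in> ring_hom R F"
    and epsilon_iota: "\<And>a. a \<in> carrier F \<Longrightarrow> \<epsilon> (\<iota> a) = a"
    and finite_R: "finite (carrier R)" and card_R: "card (carrier R) = 2 ^ (32 * n)"
    and finite_F: "finite (carrier F)"
    and card_F: "card (carrier F) = 2 ^ n" and two_eq_zero: "[(2::nat)] \<cdot> \<one> = \<zero>"
    and two_eq_zero_F: "[(2::nat)] \<cdot>\<^bsub>F\<^esub> \<one>\<^bsub>F\<^esub> = \<zero>\<^bsub>F\<^esub>"
    and y_closed [simp]: "y \<in> carrier R" and y_nilpotent: "y [^] (32::nat) = \<zero>"
    and decompose: "\<And>f. f \<in> carrier R \<Longrightarrow> \<exists>a\<in>carrier F. \<exists>w\<in>carrier R. f = \<iota> a \<oplus> y \<otimes> w"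
begin

sublocale hom: ring_hom_cring F R \<iota>
  using iota by unfold_locales

sublocale eps: ring_hom_cring R F \<epsilon>
  using epsilon by unfold_locales

lemma epsilon_y: "\<epsilon> y = \<zero>\<^bsub>F\<^esub>"
proof (rule ccontr)
  assume "\<epsilon> y \<noteq> \<zero>\<^bsub>F\<^esub>"
  then have "\<epsilon> y [^]\<^bsub>F\<^esub> (32::nat) \<noteq> \<zero>\<^bsub>F\<^esub>" by (intro F.nat_pow_nonzero) simp_all
  then show False using y_nilpotent by (simp flip: eps.hom_pow)
qed

sublocale U: comm_group "units_of R"
  by (rule units_comm_group)

lemma two_power_add:
  "x \<in> carrier R \<Longrightarrow> z \<in> carrier R \<Longrightarrow> (x \<oplus> z) [^] ((2::nat) ^ k) = x [^] ((2::nat) ^ k) \<oplus> z [^] ((2::nat) ^ k)"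
  by (rule frobenius_power_add[OF two_is_prime_nat two_eq_zero])

lemma two_power_add_F:
  "x \<in> carrier F \<Longrightarrow> z \<in> carrier F \<Longrightarrow>
    (x \<oplus>\<^bsub>F\<^esub> z) [^]\<^bsub>F\<^esub> ((2::nat) ^ k) = x [^]\<^bsub>F\<^esub> ((2::nat) ^ k) \<oplus>\<^bsub>F\<^esub> z [^]\<^bsub>F\<^esub> ((2::nat) ^ k)"
  by (rule F.frobenius_power_add[OF two_is_prime_nat two_eq_zero_F])

lemma minus_F: "x \<in> carrier F \<Longrightarrow> \<ominus>\<^bsub>F\<^esub> x = x"
proof (rule F.minus_equality)
  assume x: "x \<in> carrier F"
  have "[(2::nat)] \<cdot>\<^bsub>F\<^esub> x = x \<oplus>\<^bsub>F\<^esub> x" using x by (simp add: numeral_2_eq_2)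
  then show "x \<oplus>\<^bsub>F\<^esub> x = \<zero>\<^bsub>F\<^esub>"
    using F.add_pow_eq_zero[OF two_eq_zero_F dvd_refl x] by simp
qed

text \<open>The power map is additive with trivial kernel, hence injective, hence onto, since
  \<open>F\<close> is finite. As every element is its own negative, the sum of \<open>c\<close> and
  \<open>d\<close> serves as their difference.\<close>

lemma frobenius_surj:
  assumes "a \<in> carrier F"
  shows "\<exists>c\<in>carrier F. c [^]\<^bsub>F\<^esub> ((2::nat) ^ k) = a"
proof -
  let ?\<phi> = "\<lambda>c. c [^]\<^bsub>F\<^esub> ((2::nat) ^ k)"
  have "inj_on ?\<phi> (carrier F)"
  proof (rule inj_onI)
    fix c d assume cd: "c \<in> carrier F" "d \<in> carrier F" "?\<phi> c = ?\<phi> d"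
    have "?\<phi> (c \<oplus>\<^bsub>F\<^esub> d) = \<zero>\<^bsub>F\<^esub>"
      using cd F.r_neg[of "?\<phi> d"] by (simp add: two_power_add_F minus_F)
    then have "c \<oplus>\<^bsub>F\<^esub> d = \<zero>\<^bsub>F\<^esub>"
      using cd F.nat_pow_nonzero[of "c \<oplus>\<^bsub>F\<^esub> d"] by blast
    then have "\<ominus>\<^bsub>F\<^esub> d = c" using cd by (intro F.minus_equality) simp_all
    then show "c = d" using minus_F[OF cd(2)] by simp
  qed
  then have "?\<phi> ` carrier F = carrier F"
    by (intro endo_inj_surj finite_F) auto
  then have "a \<in> ?\<phi> ` carrier F" using assms by simp
  then show ?thesis by (elim imageE) blast
qed

lemma y_power_eq_zero: "32 \<le> k \<Longrightarrow> y [^] (k::nat) = \<zero>"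
  using y_nilpotent nat_pow_mult[OF y_closed, of 32 "k - 32"] by simp

lemma generator_power:
  assumes "b \<in> carrier F"
  shows "(\<one> \<oplus> \<iota> b \<otimes> y [^] (j::nat)) [^] ((2::nat) ^ k)
    = \<one> \<oplus> \<iota> (b [^]\<^bsub>F\<^esub> ((2::nat) ^ k)) \<otimes> y [^] (j * 2 ^ k)"
  using assms by (simp add: two_power_add nat_pow_distrib nat_pow_pow hom.hom_pow)

lemma power_eq_one_imp_Unit:
  assumes "x \<in> carrier R" "x [^] (m::nat) = \<one>" "m > 0"
  shows "x \<in> Units R"
proof -
  obtain l where l: "m = Suc l" using assms(3) by (metis not0_implies_Suc less_numeral_extra(3))
  then have "x [^] l \<otimes> x = \<one>" using assms by simp
  then show ?thesis using assms(1) by (auto simp: Units_def m_comm intro!: bexI[of _ "x [^] l"])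
qed

text \<open>The 32nd power is \<open>1 + y ^ 32 w ^ 32 = 1\<close>.\<close>

lemma one_plus_y_Unit:
  assumes "w \<in> carrier R"
  shows "\<one> \<oplus> y \<otimes> w \<in> Units R"
proof (rule power_eq_one_imp_Unit)
  show "(\<one> \<oplus> y \<otimes> w) [^] ((2::nat) ^ 5) = \<one>"
    unfolding two_power_add[OF one_closed m_closed[OF y_closed assms]] nat_pow_distrib[OF y_closed assms]
    using y_nilpotent assms by simp
qed (use assms in auto)

lemma subgroup_units_pow:
  assumes "subgroup H (units_of R)" "x \<in> H"
  shows "x [^] (i::nat) \<in> H"
proof (induction i)
  case 0
  then show ?case using subgroup.one_closed[OF assms(1)] by (simp add: units_of_one)
next
  case (Suc i)
  then show ?case using subgroup.m_closed[OF assms(1) _ assms(2)] by (simp add: units_of_mult)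
qed

lemma iota_inv:
  assumes "a \<in> carrier F" "a \<noteq> \<zero>\<^bsub>F\<^esub>"
  shows "inv\<^bsub>F\<^esub> a \<in> carrier F" "\<iota> a \<otimes> \<iota> (inv\<^bsub>F\<^esub> a) = \<one>"
proof -
  have "inv\<^bsub>F\<^esub> a \<in> carrier F" "a \<otimes>\<^bsub>F\<^esub> inv\<^bsub>F\<^esub> a = \<one>\<^bsub>F\<^esub>"
    using assms F.field_Units by auto
  then show "inv\<^bsub>F\<^esub> a \<in> carrier F" "\<iota> a \<otimes> \<iota> (inv\<^bsub>F\<^esub> a) = \<one>"
    using assms(1) by (simp_all flip: hom.hom_mult)
qed

lemma factor_unit:
  assumes a: "a \<in> carrier F" "a \<noteq> \<zero>\<^bsub>F\<^esub>" and w: "w \<in> carrier R"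
  shows "\<iota> a \<oplus> y \<otimes> w = \<iota> a \<otimes> (\<one> \<oplus> y \<otimes> (\<iota> (inv\<^bsub>F\<^esub> a) \<otimes> w))"
proof -
  have "\<iota> a \<otimes> (\<one> \<oplus> y \<otimes> (\<iota> (inv\<^bsub>F\<^esub> a) \<otimes> w)) = \<iota> a \<oplus> y \<otimes> ((\<iota> a \<otimes> \<iota> (inv\<^bsub>F\<^esub> a)) \<otimes> w)"
    using a w iota_inv(1)[OF a] by (simp add: r_distr m_ac)
  then show ?thesis using iota_inv(2)[OF a] w by simp
qed

text \<open>The constant term is \<open>\<epsilon> f\<close>, since \<open>\<epsilon>\<close> kills
  \<open>y\<close>; dividing by it leaves 1 plus a multiple of \<open>y\<close>.\<close>

lemma Unit_if_epsilon_nonzero: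
  assumes f: "f \<in> carrier R" "\<epsilon> f \<noteq> \<zero>\<^bsub>F\<^esub>"
  shows "f \<in> Units R"
proof -
  obtain a w where aw: "a \<in> carrier F" "w \<in> carrier R" "f = \<iota> a \<oplus> y \<otimes> w"
    using decompose[OF f(1)] by blast
  then have a: "a \<noteq> \<zero>\<^bsub>F\<^esub>"
    using f(2) epsilon_iota[OF aw(1)] epsilon_y by auto
  have "\<iota> a \<in> Units R"
    using iota_inv[OF aw(1) a] aw(1) by (auto simp: Units_def m_comm intro!: bexI[of _ "\<iota> (inv\<^bsub>F\<^esub> a)"])
  then show ?thesis
    unfolding aw(3) factor_unit[OF aw(1) a aw(2)]
    using iota_inv(1)[OF aw(1) a] aw(2) by (intro Units_m_closed one_plus_y_Unit) auto
qed

text \<open>A lower bound is what the counting argument asks for. Different constants shift the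
  kernel \<open>K\<close> of \<open>\<epsilon>\<close> to disjoint sets, so \<open>K\<close> has at
  most \<open>2 ^ (31 * n)\<close> elements, and everything outside \<open>K\<close> is a
  unit.\<close>

lemma card_Units: "(2 ^ n - 1) * 2 ^ (31 * n) \<le> card (Units R)"
proof -
  define K where "K = {f \<in> carrier R. \<epsilon> f = \<zero>\<^bsub>F\<^esub>}"
  have "inj_on (\<lambda>(a, k). \<iota> a \<oplus> k) (carrier F \<times> K)"
  proof (rule inj_onI, clarify)
    fix a k b l assume ab: "a \<in> carrier F" "b \<in> carrier F" and kl: "k \<in> K" "l \<in> K"
      and eq: "\<iota> a \<oplus> k = \<iota> b \<oplus> l"
    from arg_cong[OF eq, of \<epsilon>] have "a = b"
      using ab kl by (simp add: K_def epsilon_iota)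
    then show "a = b \<and> k = l" using eq ab kl by (simp add: K_def)
  qed
  moreover have "(\<lambda>(a, k). \<iota> a \<oplus> k) ` (carrier F \<times> K) \<subseteq> carrier R"
    by (auto simp: K_def)
  ultimately have "card (carrier F \<times> K) \<le> card (carrier R)"
    using finite_R by (rule card_inj_on_le)
  then have "2 ^ n * card K \<le> 2 ^ n * 2 ^ (31 * n)"
    by (simp add: card_cartesian_product card_F card_R flip: power_add)
  then have K: "card K \<le> 2 ^ (31 * n)" by simp
  have "(2 ^ n - 1) * 2 ^ (31 * n) = (2::nat) ^ (32 * n) - 2 ^ (31 * n)"
    by (simp add: diff_mult_distrib flip: power_add)
  also have "\<dots> \<le> card (carrier R) - card K" using K card_R by simp
  also have "\<dots> = card (carrier R - K)"
    using finite_R by (intro card_Diff_subset[symmetric]) (auto simp: K_def)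
  also have "\<dots> \<le> card (Units R)"
    using Unit_if_epsilon_nonzero finite_R
    by (intro card_mono) (auto simp: K_def Units_def)
  finally show ?thesis .
qed

text \<open>The coefficients \<open>c\<close> for which some element of \<open>H\<close> has leading term \<open>c ^ (2 ^ k) y ^ m\<close>
  form an additive group, which therefore is all of \<open>F\<close> as soon as it contains generators.\<close>

lemma leading_coefficients:
  assumes H: "subgroup H (units_of R)" and m: "m > 0"
    and b: "\<And>i. i < n \<Longrightarrow> b i \<in> carrier F"
    and span: "generate (add_monoid F) (b ` {..<n}) = carrier F"
    and mem: "\<And>i. i < n \<Longrightarrow> \<one> \<oplus> \<iota> (b i [^]\<^bsub>F\<^esub> ((2::nat) ^ k)) \<otimes> y [^] m \<in> H"
    and a: "a \<in> carrier F"
  shows "\<exists>w\<in>carrier R. \<one> \<oplus> \<iota> a \<otimes> y [^] (m::nat) \<oplus> y [^] Suc m \<otimes> w \<in> H"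
proof -
  define T where "T = {c \<in> carrier F. \<exists>w\<in>carrier R.
    \<one> \<oplus> \<iota> (c [^]\<^bsub>F\<^esub> ((2::nat) ^ k)) \<otimes> y [^] m \<oplus> y [^] Suc m \<otimes> w \<in> H}"
  have "subgroup T (add_monoid F)"
  proof (rule F.add.subgroupI)
    show "T \<subseteq> carrier F" by (auto simp: T_def)
    have "\<one> \<in> H" using subgroup.one_closed[OF H] by (simp add: units_of_one)
    moreover have "\<zero>\<^bsub>F\<^esub> [^]\<^bsub>F\<^esub> ((2::nat) ^ k) = \<zero>\<^bsub>F\<^esub>" by (rule F.nat_pow_zero) simp
    ultimately have "\<zero>\<^bsub>F\<^esub> \<in> T" by (auto simp: T_def intro!: bexI[of _ \<zero>])
    then show "T \<noteq> {}" by blast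
    show "\<ominus>\<^bsub>F\<^esub> c \<in> T" if "c \<in> T" for c
      using that minus_F[of c] by (auto simp: T_def)
    fix c d assume "c \<in> T" "d \<in> T"
    then obtain v w where cd: "c \<in> carrier F" "d \<in> carrier F" and vw: "v \<in> carrier R" "w \<in> carrier R"
      and vH: "\<one> \<oplus> \<iota> (c [^]\<^bsub>F\<^esub> ((2::nat) ^ k)) \<otimes> y [^] m \<oplus> y [^] Suc m \<otimes> v \<in> H"
      and wH: "\<one> \<oplus> \<iota> (d [^]\<^bsub>F\<^esub> ((2::nat) ^ k)) \<otimes> y [^] m \<oplus> y [^] Suc m \<otimes> w \<in> H"
      by (auto simp: T_def)
    define C D where "C = \<iota> (c [^]\<^bsub>F\<^esub> ((2::nat) ^ k))" and "D = \<iota> (d [^]\<^bsub>F\<^esub> ((2::nat) ^ k))"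
    \<comment> \<open>With \<open>Z = y ^ l\<close> one has \<open>y ^ m = Z y\<close> and
      \<open>y ^ Suc m = Z y y\<close>, so the product below is a plain ring identity. The cross
      term \<open>C D y ^ (2 m)\<close> is a multiple of \<open>y ^ Suc m\<close> because
      \<open>m > 0\<close>.\<close>
    obtain l where l: "m = Suc l" using m by (metis gr0_implies_Suc)
    define Z where "Z = y [^] l"
    have [simp]: "C \<in> carrier R" "D \<in> carrier R" "Z \<in> carrier R"
      using cd by (simp_all add: C_def D_def Z_def)
    let ?u = "v \<oplus> w \<oplus> C \<otimes> D \<otimes> Z \<oplus> C \<otimes> (Z \<otimes> y) \<otimes> w \<oplus> D \<otimes> (Z \<otimes> y) \<otimes> v \<oplus> Z \<otimes> y \<otimes> y \<otimes> v \<otimes> w"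
    have "(\<one> \<oplus> C \<otimes> (Z \<otimes> y) \<oplus> Z \<otimes> y \<otimes> y \<otimes> v) \<otimes> (\<one> \<oplus> D \<otimes> (Z \<otimes> y) \<oplus> Z \<otimes> y \<otimes> y \<otimes> w)
      = \<one> \<oplus> (C \<oplus> D) \<otimes> (Z \<otimes> y) \<oplus> Z \<otimes> y \<otimes> y \<otimes> ?u"
      using vw by (simp add: l_distr r_distr m_ac a_ac)
    moreover have "(\<one> \<oplus> C \<otimes> (Z \<otimes> y) \<oplus> Z \<otimes> y \<otimes> y \<otimes> v) \<otimes> (\<one> \<oplus> D \<otimes> (Z \<otimes> y) \<oplus> Z \<otimes> y \<otimes> y \<otimes> w) \<in> H"
      using subgroup.m_closed[OF H vH wH] by (simp add: units_of_mult C_def D_def Z_def l)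
    moreover have "C \<oplus> D = \<iota> ((c \<oplus>\<^bsub>F\<^esub> d) [^]\<^bsub>F\<^esub> ((2::nat) ^ k))"
      using cd by (simp add: C_def D_def two_power_add_F)
    ultimately have "\<one> \<oplus> \<iota> ((c \<oplus>\<^bsub>F\<^esub> d) [^]\<^bsub>F\<^esub> ((2::nat) ^ k)) \<otimes> y [^] m \<oplus> y [^] Suc m \<otimes> ?u \<in> H"
      by (simp add: Z_def l)
    moreover have "?u \<in> carrier R" using vw by simp
    ultimately show "c \<oplus>\<^bsub>F\<^esub> d \<in> T"
      using cd unfolding T_def by blast
  qed
  moreover have "b ` {..<n} \<subseteq> T"
    using b mem by (fastforce simp: T_def intro!: bexI[of _ \<zero>])
  ultimately have "T = carrier F"
    using F.add.generate_subgroup_incl[of "b ` {..<n}" T] span by (auto simp: T_def)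
  \<comment> \<open>Every \<open>a\<close> is itself a \<open>2 ^ k\<close>-th power, so
    coefficients of that shape are all coefficients.\<close>
  moreover obtain c where "c \<in> carrier F" "c [^]\<^bsub>F\<^esub> ((2::nat) ^ k) = a"
    using frobenius_surj[OF a] by blast
  ultimately show ?thesis by (auto simp: T_def)
qed

text \<open>Write \<open>m = 2 ^ k j\<close> with \<open>j\<close> odd: the \<open>2 ^ k\<close>-th
  powers of the given elements at level \<open>j\<close> lie at level \<open>m\<close>. Hence some
  \<open>h\<close> in \<open>H\<close> agrees with the target modulo \<open>y ^ Suc m\<close>, and
  the quotient is covered by the induction hypothesis.\<close>

lemma one_plus_y_power_mem:
  assumes H: "subgroup H (units_of R)"
    and b: "\<And>i. i < n \<Longrightarrow> b i \<in> carrier F"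
    and span: "generate (add_monoid F) (b ` {..<n}) = carrier F"
    and mem: "\<And>i t. i < n \<Longrightarrow> t < 16 \<Longrightarrow> \<one> \<oplus> \<iota> (b i) \<otimes> y [^] Suc (2 * t) \<in> H"
    and m: "0 < m" "m \<le> 32" and w: "w \<in> carrier R"
  shows "\<one> \<oplus> y [^] (m::nat) \<otimes> w \<in> H"
  using m(2,1) w
proof (induction m arbitrary: w rule: inc_induct)
  case base
  then show ?case
    using subgroup.one_closed[OF H] y_nilpotent by (simp add: units_of_one)
next
  case (step m)
  obtain k j where kj: "m = 2 ^ k * j" "odd j"
    by (rule multiplicity_decompose'[of m 2]) (use step.prems(1) in simp_all)
  then obtain t where t: "j = Suc (2 * t)" by (metis oddE Suc_eq_plus1)
  have "j \<le> m" using kj by simp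
  then have t16: "t < 16" using t step.hyps by simp
  have sub: "H \<subseteq> Units R" using subgroup.subset[OF H] by (simp add: units_of_carrier)
  note powH = subgroup_units_pow[OF H]
  have gens: "\<one> \<oplus> \<iota> (b i [^]\<^bsub>F\<^esub> ((2::nat) ^ k)) \<otimes> y [^] m \<in> H" if i: "i < n" for i
    using powH[OF mem[OF i t16], of "2 ^ k"] unfolding generator_power[OF b[OF i]]
    by (simp add: kj t mult.commute)
  obtain a v where av: "a \<in> carrier F" "v \<in> carrier R" "w = \<iota> a \<oplus> y \<otimes> v"
    using decompose[OF step.prems(2)] by blast
  obtain u where u: "u \<in> carrier R" "\<one> \<oplus> \<iota> a \<otimes> y [^] m \<oplus> y [^] Suc m \<otimes> u \<in> H"
    using leading_coefficients[where b = b and k = k, OF H step.prems(1) _ span _ av(1)] b gens by blast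
  \<comment> \<open>The target is \<open>h + y ^ Suc m (v - u)\<close>, which is \<open>h\<close>
    times \<open>1 + y ^ Suc m (v - u) inv h\<close>; the latter factor lies in \<open>H\<close> by
    induction.\<close>
  define h where "h = \<one> \<oplus> \<iota> a \<otimes> y [^] m \<oplus> y [^] Suc m \<otimes> u"
  have h: "h \<in> H" "h \<in> Units R" "h \<in> carrier R" using u sub by (auto simp: h_def)
  have "\<one> \<oplus> y [^] Suc m \<otimes> ((v \<ominus> u) \<otimes> inv h) \<in> H"
    using step.IH[of "(v \<ominus> u) \<otimes> inv h"] av u h by simp
  then have "(\<one> \<oplus> y [^] Suc m \<otimes> ((v \<ominus> u) \<otimes> inv h)) \<otimes> h \<in> H"
    using subgroup.m_closed[OF H _ h(1)] by (simp add: units_of_mult)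
  also have "(\<one> \<oplus> y [^] Suc m \<otimes> ((v \<ominus> u) \<otimes> inv h)) \<otimes> h = h \<oplus> y [^] Suc m \<otimes> (v \<ominus> u)"
    using h av u by (simp add: l_distr m_assoc del: nat_pow_Suc)
  also have "\<dots> = \<one> \<oplus> y [^] m \<otimes> w"
  proof -
    have "y [^] m \<in> carrier R" "\<iota> a \<in> carrier R" using av by simp_all
    then show ?thesis using av(2) u(1) y_closed unfolding h_def av(3) nat_pow_Suc by algebra
  qed
  finally show ?case .
qed

lemma units_iso:
  assumes n: "n > 0"
  shows "units_of R \<cong> cyclic_power 32 n \<times>\<times> cyclic_power 16 n \<times>\<times> cyclic_power 8 (2 * n)
    \<times>\<times> cyclic_power 4 (4 * n) \<times>\<times> cyclic_power 2 (8 * n) \<times>\<times> integer_mod_group (2 ^ n - 1)"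
proof -
  obtain b where b: "\<And>i. i < n \<Longrightarrow> b i \<in> carrier F"
    and span: "generate (add_monoid F) (b ` {..<n}) = carrier F"
    using F.add.generated_by_log2_order[of n] finite_F card_F by auto
  obtain g where g: "g \<in> carrier F" "g \<noteq> \<zero>\<^bsub>F\<^esub>"
    "\<And>x. x \<in> carrier F \<Longrightarrow> x \<noteq> \<zero>\<^bsub>F\<^esub> \<Longrightarrow> \<exists>i::nat. x = g [^]\<^bsub>F\<^esub> i"
    using F.finite_field_generator[OF finite_F] by metis
  define q where "q = (2::nat) ^ n - 1"
  have q: "q > 0" using one_less_power[of "2::nat" n] n by (simp add: q_def)
  \<comment> \<open>\<open>\<kappa> t\<close> is the least \<open>k\<close> with
    \<open>(2 t + 1) 2 ^ k \<ge> 32\<close>, so the generators built from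
    \<open>y ^ (2 t + 1)\<close> have \<open>2 ^ \<kappa> t\<close>-th power 1.\<close>
  define \<kappa> where "\<kappa> t = (if t < 1 then 5 else if t < 2 then 4 else if t < 4 then 3 else if t < 8 then 2 else (1::nat))"
    for t :: nat
  define ord where "ord i = (if i < 16 * n then 2 ^ \<kappa> (i div n) else q)" for i
  \<comment> \<open>An index \<open>i < 16 * n\<close> stands for the odd power of \<open>y\<close>
    numbered \<open>i div n\<close> with coefficient \<open>b (i mod n)\<close>; the last index
    \<open>16 * n\<close> is left for the generator of the multiplicative group of
    \<open>F\<close>.\<close>
  define e where "e i = (if i < 16 * n then \<one> \<oplus> \<iota> (b (i mod n)) \<otimes> y [^] Suc (2 * (i div n)) else \<iota> g)" for i
  let ?I = "{..<16 * n + 1}"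
  have e_closed: "e i \<in> carrier R" if "i \<in> ?I" for i
    using b[of "i mod n"] n g(1) by (auto simp: e_def)
  have e_ord: "e i [^] ord i = \<one>" if "i \<in> ?I" for i
  proof (cases "i < 16 * n")
    case True
    let ?t = "i div n"
    have "?t < 16" using True by (simp add: less_mult_imp_div_less)
    then have "32 \<le> Suc (2 * ?t) * 2 ^ \<kappa> ?t"
      by (auto simp: \<kappa>_def)
    then have "y [^] (Suc (2 * ?t) * 2 ^ \<kappa> ?t) = \<zero>" by (rule y_power_eq_zero)
    then have "(\<one> \<oplus> \<iota> (b (i mod n)) \<otimes> y [^] Suc (2 * ?t)) [^] ((2::nat) ^ \<kappa> ?t) = \<one>"
      using b[of "i mod n"] n by (subst generator_power) simp_all
    then show ?thesis using True by (simp add: e_def ord_def)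
  next
    case False
    have "g [^]\<^bsub>F\<^esub> q = \<one>\<^bsub>F\<^esub>"
      using F.finite_field_power_card[OF finite_F g(1,2)] by (simp add: card_F q_def)
    then show ?thesis using False g(1) by (simp add: e_def ord_def flip: hom.hom_pow)
  qed
  have ord_pos: "ord i > 0" for i using q by (simp add: ord_def)
  have e_Unit: "e i \<in> Units R" if "i \<in> ?I" for i
    using that e_closed e_ord ord_pos by (blast intro: power_eq_one_imp_Unit)
  have gen: "generate (units_of R) (e ` ?I) = carrier (units_of R)"
  proof
    show "generate (units_of R) (e ` ?I) \<subseteq> carrier (units_of R)"
      using e_Unit by (intro U.generate_incl) (auto simp: units_of_carrier)
    define H where "H = generate (units_of R) (e ` ?I)"
    have H: "subgroup H (units_of R)"
      unfolding H_def using e_Unit by (intro U.generate_is_subgroup) (auto simp: units_of_carrier)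
    have eH: "e i \<in> H" if "i < 16 * n + 1" for i
      using that unfolding H_def by (auto intro: generate.incl)
    have mem: "\<one> \<oplus> \<iota> (b i) \<otimes> y [^] Suc (2 * t) \<in> H" if "i < n" "t < 16" for i t
    proof -
      have "t * n + i < 16 * n"
      proof -
        have "Suc t * n \<le> 16 * n" using that(2) by (intro mult_le_mono1) simp
        then show ?thesis using that(1) unfolding mult_Suc by linarith
      qed
      moreover have "(t * n + i) div n = t" "(t * n + i) mod n = i" using that by auto
      ultimately show ?thesis using eH[of "t * n + i"] by (simp add: e_def)
    qed
    have one_plus: "\<one> \<oplus> y \<otimes> w \<in> H" if "w \<in> carrier R" for w
      using one_plus_y_power_mem[where b = b and m = 1, OF H _ span _ _ _ that] b mem by simp
    have iota_mem: "\<iota> a \<in> H" if "a \<in> carrier F" "a \<noteq> \<zero>\<^bsub>F\<^esub>" for a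
    proof -
      from g(3)[OF that] obtain i :: nat where i: "a = g [^]\<^bsub>F\<^esub> i" by (rule exE)
      have "\<iota> g \<in> H" using eH[of "16 * n"] by (simp add: e_def)
      then have "\<iota> g [^] i \<in> H" by (rule subgroup_units_pow[OF H])
      then show ?thesis using i g(1) by (simp add: hom.hom_pow)
    qed
    have "u \<in> H" if u: "u \<in> Units R" for u
    proof -
      obtain a w where aw: "a \<in> carrier F" "w \<in> carrier R" "u = \<iota> a \<oplus> y \<otimes> w"
        using decompose Units_closed[OF u] by blast
      have "a \<noteq> \<zero>\<^bsub>F\<^esub>"
      proof
        assume "a = \<zero>\<^bsub>F\<^esub>"
        then have "\<epsilon> u = \<zero>\<^bsub>F\<^esub>" using aw epsilon_y by simp
        moreover have "\<epsilon> u \<otimes>\<^bsub>F\<^esub> \<epsilon> (inv u) = \<one>\<^bsub>F\<^esub>"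
          using u by (simp add: Units_closed flip: eps.hom_mult)
        ultimately show False using u by simp
      qed
      then show ?thesis
        unfolding aw(3) using factor_unit[OF aw(1) _ aw(2)] iota_inv(1)[OF aw(1)] aw(1,2)
          subgroup.m_closed[OF H iota_mem one_plus]
        by (simp add: units_of_mult)
    qed
    then show "carrier (units_of R) \<subseteq> generate (units_of R) (e ` ?I)"
      by (auto simp: units_of_carrier H_def)
  qed
  have "(\<Prod>i\<in>?I. ord i) = (\<Prod>i<16 * n. 2 ^ \<kappa> (i div n)) * q"
    by (simp add: ord_def lessThan_Suc)
  also have "(\<Prod>i<16 * n. 2 ^ \<kappa> (i div n)) = (2::nat) ^ (\<Sum>i<16 * n. \<kappa> (i div n))"
    by (simp add: power_sum)
  also have "(\<Sum>i<16 * n. \<kappa> (i div n)) = n * (\<Sum>t<16. \<kappa> t)" by (rule sum_div_blocks)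
  \<comment> \<open>\<open>5 + 4 + 2 * 3 + 4 * 2 + 8 * 1 = 31\<close>, which matches the exponent
    \<open>31 * n\<close> in \<open>card_Units\<close>.\<close>
  also have "(\<Sum>t<16. \<kappa> t) = 31"
    by (simp add: \<kappa>_def numeral_eq_Suc)
  finally have prod: "(\<Prod>i\<in>?I. ord i) \<le> card (carrier (units_of R))"
    using card_Units by (simp add: units_of_carrier q_def mult.commute)
  have "units_of R \<cong> product_group ?I (\<lambda>i. integer_mod_group (ord i))"
  proof (rule U.iso_product_of_generators[OF _ _ _ ord_pos _ gen prod])
    show "finite (carrier (units_of R))"
      using finite_R by (auto simp: units_of_carrier Units_def)
    show "e i [^]\<^bsub>units_of R\<^esub> ord i = \<one>\<^bsub>units_of R\<^esub>" if "i \<in> ?I" for i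
      using e_ord[OF that] e_Unit[OF that] by (simp add: units_of_pow units_of_one)
  qed (use e_Unit in \<open>auto simp: units_of_carrier\<close>)
  also have "product_group ?I (\<lambda>i. integer_mod_group (ord i)) \<cong> cyclic_power 32 n \<times>\<times> cyclic_power 16 n
      \<times>\<times> cyclic_power 8 (2 * n) \<times>\<times> cyclic_power 4 (4 * n) \<times>\<times> cyclic_power 2 (8 * n) \<times>\<times> integer_mod_group q"
  proof -
    \<comment> \<open>The bracketing follows the nesting of the target, so each application of
      \<open>cyclic_power_split\<close> meets its block at the front.\<close>
    have I: "?I = {..<n + (n + (2 * n + (4 * n + (8 * n + 1))))}" by auto
    have "{..<1} = {0::nat}" by auto
    then have last: "product_group {..<1::nat} (\<lambda>i. integer_mod_group q) \<cong> integer_mod_group q"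
      using product_group_singleton[of 0 "\<lambda>_::nat. integer_mod_group q"] by simp
    have block: "ord i = 2 ^ \<kappa> (i div n)" "l * n \<le> i \<Longrightarrow> l \<le> i div n" "i < u * n \<Longrightarrow> i div n < u"
      if "i < 16 * n" for i l u
      using that n by (simp_all add: ord_def less_eq_div_iff_mult_less_eq less_mult_imp_div_less)
    show ?thesis unfolding I
    proof (intro cyclic_power_split)
      show "ord i = 32" if "i < n" for i
        using block(1)[of i] block(3)[of i 1] that by (simp add: \<kappa>_def)
      show "ord (n + i) = 16" if "i < n" for i
        using block(1) block(2)[of "n + i" 1] block(3)[of "n + i" 2] that by (simp add: \<kappa>_def)
      show "ord (n + (n + i)) = 8" if "i < 2 * n" for i
        using block(1) block(2)[of "n + (n + i)" 2] block(3)[of "n + (n + i)" 4] that by (simp add: \<kappa>_def)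
      show "ord (n + (n + (2 * n + i))) = 4" if "i < 4 * n" for i
        using block(1) block(2)[of "n + (n + (2 * n + i))" 4] block(3)[of "n + (n + (2 * n + i))" 8] that
        by (simp add: \<kappa>_def)
      show "ord (n + (n + (2 * n + (4 * n + i)))) = 2" if "i < 8 * n" for i
        using block(1) block(2)[of "n + (n + (2 * n + (4 * n + i)))" 8] that by (simp add: \<kappa>_def)
      show "product_group {..<1} (\<lambda>i. integer_mod_group (ord (n + (n + (2 * n + (4 * n + (8 * n + i)))))))
          \<cong> integer_mod_group q"
        using last by (simp add: ord_def)
    qed
  qed
  finally show ?thesis by (simp add: q_def)
qed

end

section \<open>The group algebra in characteristic two\<close>

lemma (in finite_group_algebra) card_A:
  "finite (carrier R) \<Longrightarrow> card (carrier A) = card (carrier R) ^ card (carrier G)"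
  using finite_G by (simp add: carrier_A card_PiE)

lemma (in finite_group_algebra) finite_A: "finite (carrier R) \<Longrightarrow> finite (carrier A)"
  using finite_G by (simp add: carrier_A finite_PiE)

lemma (in finite_group_algebra) single_ring_hom: "(\<lambda>a. single a \<one>\<^bsub>G\<^esub>) \<in> ring_hom R A"
proof (rule ring_hom_memI)
  fix a b assume ab: "a \<in> carrier R" "b \<in> carrier R"
  show "single (a \<otimes> b) \<one>\<^bsub>G\<^esub> = single a \<one>\<^bsub>G\<^esub> \<otimes>\<^bsub>A\<^esub> single b \<one>\<^bsub>G\<^esub>"
    using ab by (simp add: single_mult_single)
  show "single (a \<oplus> b) \<one>\<^bsub>G\<^esub> = single a \<one>\<^bsub>G\<^esub> \<oplus>\<^bsub>A\<^esub> single b \<one>\<^bsub>G\<^esub>"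
    using ab by (auto simp: add_A single_def)
qed (simp_all add: single_closed one_A)

lemma (in finite_group_algebra) sum_single:
  assumes "a \<in> carrier R" "g \<in> carrier G"
  shows "(\<Oplus>x\<in>carrier G. single a g x) = a"
proof -
  have "(\<Oplus>x\<in>carrier G. single a g x) = (\<Oplus>x\<in>carrier G. if x = g then a else \<zero>)"
    using assms(1) by (intro R.finsum_cong' refl) (auto simp: single_def)
  also have "\<dots> = a"
    using assms finite_G by (intro R.add.finprod_singleton_swap[where f = "\<lambda>_. a"]) auto
  finally show ?thesis .
qed

lemma (in finite_group_algebra) augmentation_ring_hom:
  "(\<lambda>f. \<Oplus>x\<in>carrier G. f x) \<in> ring_hom A R"
proof (rule ring_hom_memI)
  fix f h assume f: "f \<in> carrier A" and h: "h \<in> carrier A"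
  note c = coeff_closed[OF f] coeff_closed[OF h]
  show "(\<Oplus>x\<in>carrier G. f x) \<in> carrier R" using c by (intro R.finsum_closed) auto
  have id: "(\<lambda>x. x) \<in> ring_hom R R" by (auto intro: ring_hom_memI)
  have "(\<Oplus>x\<in>carrier G. k x \<otimes> \<one>) = (\<Oplus>x\<in>carrier G. k x)" if "k \<in> carrier A" for k
    using coeff_closed[OF that] by (intro R.finsum_cong' refl) auto
  then show "(\<Oplus>x\<in>carrier G. (f \<otimes>\<^bsub>A\<^esub> h) x) = (\<Oplus>x\<in>carrier G. f x) \<otimes> (\<Oplus>x\<in>carrier G. h x)"
    using character_sum_mult[OF R.is_cring id, of "\<lambda>_. \<one>", OF _ _ f h] f h mult_closed[OF f h] by simp
  have "(\<Oplus>x\<in>carrier G. (f \<oplus>\<^bsub>A\<^esub> h) x) = (\<Oplus>x\<in>carrier G. f x \<oplus> h x)"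
    using c by (intro R.finsum_cong' refl) (auto simp: add_A)
  then show "(\<Oplus>x\<in>carrier G. (f \<oplus>\<^bsub>A\<^esub> h) x) = (\<Oplus>x\<in>carrier G. f x) \<oplus> (\<Oplus>x\<in>carrier G. h x)"
    using c by (simp add: R.finsum_addf)
next
  show "(\<Oplus>x\<in>carrier G. \<one>\<^bsub>A\<^esub> x) = \<one>" by (simp add: one_A sum_single)
qed

lemma units_group_algebra_char_two:
  fixes F :: "('a, 'm) ring_scheme"
  assumes "field F" and fin: "finite (carrier F)" and two: "[(2::nat)] \<cdot>\<^bsub>F\<^esub> \<one>\<^bsub>F\<^esub> = \<zero>\<^bsub>F\<^esub>"
    and card: "card (carrier F) = 2 ^ n" and n: "n > 0"
  shows "units_of (group_algebra F (integer_mod_group 32)) \<cong> cyclic_power 32 n \<times>\<times> cyclic_power 16 n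
    \<times>\<times> cyclic_power 8 (2 * n) \<times>\<times> cyclic_power 4 (4 * n) \<times>\<times> cyclic_power 2 (8 * n)
    \<times>\<times> integer_mod_group (2 ^ n - 1)"
proof -
  interpret F: field F by fact
  have Z: "carrier (integer_mod_group 32) = {0..<32}" by (simp add: carrier_integer_mod_group)
  interpret FG: finite_group_algebra F "integer_mod_group 32"
    by (intro finite_group_algebra.intro finite_group_algebra_axioms.intro F.is_cring) (simp_all add: Z)
  \<comment> \<open>The generator of the cyclic group, called \<open>X\<close> in the
    overview.\<close>
  define u where "u = FG.single \<one>\<^bsub>F\<^esub> 1"
  have u [simp]: "u \<in> carrier FG.A" by (simp add: u_def FG.single_closed)
  have u_pow: "u [^]\<^bsub>FG.A\<^esub> k = FG.single \<one>\<^bsub>F\<^esub> (int k mod 32)" for k :: nat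
  proof (induction k)
    case 0
    then show ?case by (simp add: FG.one_A)
  next
    case (Suc k)
    have "FG.single \<one>\<^bsub>F\<^esub> (int k mod 32) \<otimes>\<^bsub>FG.A\<^esub> u = FG.single \<one>\<^bsub>F\<^esub> ((int k mod 32 + 1) mod 32)"
      unfolding u_def by (subst FG.single_mult_single) (simp_all add: Z)
    also have "(int k mod 32 + 1) mod 32 = (int k + 1) mod 32" by (rule mod_add_left_eq)
    also have "int k + 1 = int (Suc k)" by simp
    finally show ?case using Suc by simp
  qed
  define y where "y = u \<oplus>\<^bsub>FG.A\<^esub> \<one>\<^bsub>FG.A\<^esub>"
  have double: "a \<oplus>\<^bsub>F\<^esub> a = \<zero>\<^bsub>F\<^esub>" if "a \<in> carrier F" for a
    using F.add_pow_eq_zero[OF two dvd_refl that] that by (simp add: numeral_2_eq_2)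
  have "\<one>\<^bsub>FG.A\<^esub> \<oplus>\<^bsub>FG.A\<^esub> \<one>\<^bsub>FG.A\<^esub> = \<zero>\<^bsub>FG.A\<^esub>"
    by (auto simp: FG.add_A FG.zero_A FG.one_A FG.single_def double)
  then have two_A: "[(2::nat)] \<cdot>\<^bsub>FG.A\<^esub> \<one>\<^bsub>FG.A\<^esub> = \<zero>\<^bsub>FG.A\<^esub>" by (simp add: numeral_2_eq_2)
  have y_pow: "y [^]\<^bsub>FG.A\<^esub> (32::nat) = \<zero>\<^bsub>FG.A\<^esub>"
  proof -
    have "y [^]\<^bsub>FG.A\<^esub> ((2::nat) ^ 5) = u [^]\<^bsub>FG.A\<^esub> ((2::nat) ^ 5) \<oplus>\<^bsub>FG.A\<^esub> \<one>\<^bsub>FG.A\<^esub> [^]\<^bsub>FG.A\<^esub> ((2::nat) ^ 5)"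
      unfolding y_def by (intro FG.A.frobenius_power_add two_is_prime_nat two_A) simp_all
    also have "u [^]\<^bsub>FG.A\<^esub> ((2::nat) ^ 5) = \<one>\<^bsub>FG.A\<^esub>" by (simp add: u_pow FG.one_A)
    finally show ?thesis
      using \<open>\<one>\<^bsub>FG.A\<^esub> \<oplus>\<^bsub>FG.A\<^esub> \<one>\<^bsub>FG.A\<^esub> = \<zero>\<^bsub>FG.A\<^esub>\<close> by simp
  qed
  text \<open>Multiplication by \<open>y = u + 1\<close> takes differences of neighbouring coefficients, so
    the partial sums of \<open>f\<close> give a preimage of \<open>f\<close> up to a constant.\<close>
  have decompose: "\<exists>a\<in>carrier F. \<exists>w\<in>carrier FG.A. f = FG.single a \<one>\<^bsub>integer_mod_group 32\<^esub> \<oplus>\<^bsub>FG.A\<^esub> y \<otimes>\<^bsub>FG.A\<^esub> w"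
    if f: "f \<in> carrier FG.A" for f
  proof -
    define s where "s k = (\<Oplus>\<^bsub>F\<^esub>i\<in>{..<k}. f (int i))" for k :: nat
    have fi: "f i \<in> carrier F" if "0 \<le> i" "i < 32" for i
      using FG.coeff_closed[OF f] that by (simp add: Z)
    have s_closed: "s k \<in> carrier F" if "k \<le> 32" for k
      using that unfolding s_def by (intro F.finsum_closed) (auto simp: fi)
    have s_Suc: "s (Suc k) = f (int k) \<oplus>\<^bsub>F\<^esub> s k" if "k < 32" for k
      using that unfolding s_def lessThan_Suc by (intro F.finsum_insert) (auto simp: fi)
    \<comment> \<open>\<open>Suc\<close> makes the partial sum at \<open>x\<close> include
      \<open>f x\<close>, so consecutive values differ by \<open>f x\<close>. The wrap-around at
      \<open>x = 0\<close> meets \<open>w 31 = s 32\<close>, which the constant \<open>s 32\<close>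
      cancels in characteristic 2.\<close>
    define w where "w = (\<lambda>x\<in>carrier (integer_mod_group 32). s (Suc (nat x)))"
    have w: "w \<in> carrier FG.A" by (auto simp: w_def FG.carrier_A Z s_closed)
    have yw: "(y \<otimes>\<^bsub>FG.A\<^esub> w) x = w ((31 + x) mod 32) \<oplus>\<^bsub>F\<^esub> w x" if x: "x \<in> {0..<32}" for x
    proof -
      have "w ((31 + x) mod 32) \<in> carrier F" by (intro FG.coeff_closed[OF w]) (simp add: Z)
      moreover have "y \<otimes>\<^bsub>FG.A\<^esub> w = u \<otimes>\<^bsub>FG.A\<^esub> w \<oplus>\<^bsub>FG.A\<^esub> w"
        unfolding y_def using w by (simp add: FG.A.l_distr)
      \<comment> \<open>The inverse of the generator is the residue 31, so multiplication by
        \<open>u\<close> reads \<open>w\<close> at the preceding index.\<close>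
      moreover have "inv\<^bsub>integer_mod_group 32\<^esub> 1 = 31"
        by (subst inv_integer_mod_group) (simp_all add: Z)
      ultimately show ?thesis
        using x unfolding u_def FG.add_A by (simp add: FG.single_mult[OF _ _ w] Z)
    qed
    have "f = FG.single (s 32) \<one>\<^bsub>integer_mod_group 32\<^esub> \<oplus>\<^bsub>FG.A\<^esub> y \<otimes>\<^bsub>FG.A\<^esub> w"
    proof (rule FG.A_eqI[OF f])
      fix x assume "x \<in> carrier (integer_mod_group 32)"
      then have x: "0 \<le> x" "x < 32" by (simp_all add: Z)
      show "f x = (FG.single (s 32) \<one>\<^bsub>integer_mod_group 32\<^esub> \<oplus>\<^bsub>FG.A\<^esub> y \<otimes>\<^bsub>FG.A\<^esub> w) x"
      proof (cases "x = 0")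
        case True
        have "s 32 \<oplus>\<^bsub>F\<^esub> (s 32 \<oplus>\<^bsub>F\<^esub> f 0) = f 0"
          using s_closed[of 32] fi[of 0] double by (simp flip: F.a_assoc)
        moreover have "s 1 = f 0"
          using s_Suc[of 0] fi[of 0] by (simp add: s_def)
        ultimately show ?thesis
          using yw[of 0] True by (simp add: FG.add_A FG.single_def Z w_def)
      next
        case False
        have "(31 + x) mod 32 = (x - 1 + 32) mod 32"
          by (rule arg_cong[of _ _ "\<lambda>z. z mod 32"]) simp
        also have "\<dots> = (x - 1) mod 32" by (rule mod_add_self2)
        also have "\<dots> = x - 1" using x False by (intro mod_pos_pos_trivial) simp_all
        finally have "(31 + x) mod 32 = x - 1" .
        moreover have "s (Suc (nat x)) = f x \<oplus>\<^bsub>F\<^esub> s (nat x)"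
          using s_Suc[of "nat x"] x by simp
        moreover have "Suc (nat (x - 1)) = nat x" using x False by simp
        moreover have "s (nat x) \<oplus>\<^bsub>F\<^esub> (f x \<oplus>\<^bsub>F\<^esub> s (nat x)) = f x"
          using s_closed[of "nat x"] fi[of x] x double by (simp add: F.a_lcomm)
        ultimately show ?thesis
          using yw[of x] x False fi[of x] by (simp add: FG.add_A FG.single_def Z w_def)
      qed
    qed (use w s_closed in \<open>simp add: FG.single_closed y_def\<close>)
    then show ?thesis using s_closed[of 32] w by blast
  qed
  interpret truncated_algebra FG.A F "\<lambda>a. FG.single a \<one>\<^bsub>integer_mod_group 32\<^esub>"
    "\<lambda>f. \<Oplus>\<^bsub>F\<^esub>x\<in>carrier (integer_mod_group 32). f x" y n
  proof (intro truncated_algebra.intro truncated_algebra_axioms.intro)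
    show "cring FG.A" by (rule FG.A.is_cring)
    show "field F" by fact
    show "(\<Oplus>\<^bsub>F\<^esub>x\<in>carrier (integer_mod_group 32). FG.single a \<one>\<^bsub>integer_mod_group 32\<^esub> x) = a"
      if "a \<in> carrier F" for a
      using that by (intro FG.sum_single) simp_all
    show "card (carrier FG.A) = 2 ^ (32 * n)"
      using fin by (simp add: FG.card_A card Z power_mult mult.commute)
    show "y \<in> carrier FG.A" by (simp add: y_def)
    show "(\<lambda>a. FG.single a \<one>\<^bsub>integer_mod_group 32\<^esub>) \<in> ring_hom F FG.A"
      by (rule FG.single_ring_hom)
  qed (use fin card two two_A y_pow decompose in
      \<open>auto simp: FG.finite_A FG.augmentation_ring_hom\<close>)
  show ?thesis by (rule units_iso[OF n])
qed

section \<open>Extensions of degree eight\<close>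

text \<open>The pair \<open>(a, b)\<close> stands for \<open>a + b sqrt d\<close>. Pairs keep the
  type explicit, so that a tower of fixed height can be formed.\<close>

definition quadratic_extension :: "('a, 'm) ring_scheme \<Rightarrow> 'a \<Rightarrow> ('a \<times> 'a) ring" where
  "quadratic_extension R d =
    \<lparr>carrier = carrier R \<times> carrier R,
     monoid.mult = (\<lambda>(a, b) (c, e). (a \<otimes>\<^bsub>R\<^esub> c \<oplus>\<^bsub>R\<^esub> d \<otimes>\<^bsub>R\<^esub> (b \<otimes>\<^bsub>R\<^esub> e), a \<otimes>\<^bsub>R\<^esub> e \<oplus>\<^bsub>R\<^esub> b \<otimes>\<^bsub>R\<^esub> c)),
     one = (\<one>\<^bsub>R\<^esub>, \<zero>\<^bsub>R\<^esub>),
     ring.zero = (\<zero>\<^bsub>R\<^esub>, \<zero>\<^bsub>R\<^esub>),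
     ring.add = (\<lambda>(a, b) (c, e). (a \<oplus>\<^bsub>R\<^esub> c, b \<oplus>\<^bsub>R\<^esub> e))\<rparr>"

lemma (in cring) quadratic_extension_cring:
  assumes d: "d \<in> carrier R"
  shows "cring (quadratic_extension R d)"
proof (rule cringI)
  show "abelian_group (quadratic_extension R d)"
  proof (rule abelian_groupI)
    fix x assume "x \<in> carrier (quadratic_extension R d)"
    then show "\<exists>y\<in>carrier (quadratic_extension R d).
        y \<oplus>\<^bsub>quadratic_extension R d\<^esub> x = \<zero>\<^bsub>quadratic_extension R d\<^esub>"
      by (intro bexI[of _ "(\<ominus> fst x, \<ominus> snd x)"]) (auto simp: quadratic_extension_def l_neg)
  qed (auto simp: quadratic_extension_def a_ac)
  show "comm_monoid (quadratic_extension R d)"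
    using d by (intro comm_monoidI) (auto simp: quadratic_extension_def l_distr r_distr m_ac a_ac)
qed (use d in \<open>auto simp: quadratic_extension_def l_distr r_distr m_ac a_ac\<close>)

text \<open>The norm \<open>N = a ^ 2 - d b ^ 2\<close> of a nonzero pair is nonzero: for
  \<open>b \<noteq> 0\<close> the element \<open>d\<close> would otherwise be the square of
  \<open>a / b\<close>. The inverse is the conjugate divided by the norm.\<close>

lemma (in field) quadratic_extension_field:
  assumes d: "d \<in> carrier R" and nonsquare: "\<And>x. x \<in> carrier R \<Longrightarrow> x \<otimes> x \<noteq> d"
  shows "field (quadratic_extension R d)"
proof (rule cring.cring_fieldI[OF quadratic_extension_cring[OF d]])
  let ?K = "quadratic_extension R d"
  show "Units ?K = carrier ?K - {\<zero>\<^bsub>?K\<^esub>}"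
  proof (intro equalityI subsetI)
    fix z assume "z \<in> Units ?K"
    then show "z \<in> carrier ?K - {\<zero>\<^bsub>?K\<^esub>}"
      using d by (auto simp: Units_def quadratic_extension_def)
  next
    fix z assume "z \<in> carrier ?K - {\<zero>\<^bsub>?K\<^esub>}"
    then obtain a b where z: "z = (a, b)" and ab: "a \<in> carrier R" "b \<in> carrier R" "(a, b) \<noteq> (\<zero>, \<zero>)"
      by (auto simp: quadratic_extension_def)
    define N where "N = a \<otimes> a \<ominus> d \<otimes> (b \<otimes> b)"
    have N: "N \<in> carrier R" using ab d by (simp add: N_def)
    have "N \<noteq> \<zero>"
    proof
      assume "N = \<zero>"
      then have eq: "a \<otimes> a = d \<otimes> (b \<otimes> b)" using ab d by (simp add: N_def)
      show False
      proof (cases "b = \<zero>")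
        case True
        then show False using eq ab d by (simp add: integral_iff)
      next
        case False
        then have b: "inv b \<in> carrier R" "b \<otimes> inv b = \<one>" using ab(2) field_Units by auto
        have "(a \<otimes> inv b) \<otimes> (a \<otimes> inv b) = (a \<otimes> a) \<otimes> (inv b \<otimes> inv b)"
          using ab b by (simp add: m_ac)
        also have "\<dots> = d \<otimes> ((b \<otimes> inv b) \<otimes> (b \<otimes> inv b))"
          unfolding eq using ab(2) b(1) d by (simp add: m_ac)
        also have "\<dots> = d" using b d by simp
        finally show False using nonsquare[of "a \<otimes> inv b"] ab b by simp
      qed
    qed
    then have M: "inv N \<in> carrier R" "N \<otimes> inv N = \<one>" using N field_Units by auto
    have 1: "a \<otimes> (a \<otimes> inv N) \<oplus> d \<otimes> (b \<otimes> (\<ominus> b \<otimes> inv N)) = N \<otimes> inv N"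
      using ab d M(1) by (simp add: N_def minus_eq l_distr l_minus r_minus m_assoc)
    have 2: "a \<otimes> (\<ominus> b \<otimes> inv N) \<oplus> b \<otimes> (a \<otimes> inv N) = \<zero>"
      using ab M(1) by (simp add: l_minus r_minus m_lcomm[of a b] l_neg)
    let ?w = "(a \<otimes> inv N, \<ominus> b \<otimes> inv N)"
    have w: "?w \<in> carrier ?K" "z \<in> carrier ?K" using ab M by (simp_all add: z quadratic_extension_def)
    have zw: "z \<otimes>\<^bsub>?K\<^esub> ?w = \<one>\<^bsub>?K\<^esub>"
      using 1 2 M(2) by (simp add: z quadratic_extension_def)
    then have "?w \<otimes>\<^bsub>?K\<^esub> z = \<one>\<^bsub>?K\<^esub>"
      using comm_monoid.m_comm[OF cring.axioms(2)[OF quadratic_extension_cring[OF d]] w] by simp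
    with w zw show "z \<in> Units ?K" unfolding Units_def by blast
  qed
qed

text \<open>Squaring identifies \<open>1\<close> with \<open>-1\<close>, so it is not surjective on a finite field.\<close>

lemma (in field) exists_nonsquare:
  assumes "finite (carrier R)" "\<one> \<oplus> \<one> \<noteq> \<zero>"
  shows "\<exists>d\<in>carrier R. \<forall>x\<in>carrier R. x \<otimes> x \<noteq> d"
proof (rule ccontr)
  assume "\<not> ?thesis"
  then have "\<exists>x\<in>carrier R. x \<otimes> x = d" if "d \<in> carrier R" for d using that by simp
  then have "carrier R \<subseteq> (\<lambda>x. x \<otimes> x) ` carrier R" by (intro subsetI) (auto simp: image_iff eq_commute)
  then have "inj_on (\<lambda>x. x \<otimes> x) (carrier R)"
    using assms(1) by (intro finite_surj_inj) auto
  moreover have "\<one> \<otimes> \<one> = (\<ominus> \<one>) \<otimes> (\<ominus> \<one>)" by (simp add: l_minus r_minus)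
  ultimately have "\<one> = \<ominus> \<one>" by (elim inj_onD) simp_all
  then have "\<one> \<oplus> \<one> = \<zero>" by (metis one_closed r_neg)
  with assms(2) show False by simp
qed

text \<open>For finite fields the degree can be read off from the orders, which is the form needed
  for counting. A ring homomorphism between fields is automatically an embedding.\<close>

definition extension_of_degree ::
  "nat \<Rightarrow> ('a, 'm) ring_scheme \<Rightarrow> ('b, 'k) ring_scheme \<Rightarrow> ('a \<Rightarrow> 'b) \<Rightarrow> bool" where
  "extension_of_degree k F K \<iota> \<longleftrightarrow> field K \<and> finite (carrier K) \<and>
    card (carrier K) = card (carrier F) ^ k \<and> \<iota> \<in> ring_hom F K"

text \<open>The property \<open>1 + 1 \<noteq> 0\<close>, which yields a nonsquare, is passed on to
  \<open>K\<close> so that the step can be iterated.\<close>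

lemma extension_of_degree_two:
  fixes F :: "('a, 'm) ring_scheme"
  assumes "field F" "finite (carrier F)" "\<one>\<^bsub>F\<^esub> \<oplus>\<^bsub>F\<^esub> \<one>\<^bsub>F\<^esub> \<noteq> \<zero>\<^bsub>F\<^esub>"
  shows "\<exists>(K :: ('a \<times> 'a) ring) \<iota>. extension_of_degree 2 F K \<iota> \<and> \<one>\<^bsub>K\<^esub> \<oplus>\<^bsub>K\<^esub> \<one>\<^bsub>K\<^esub> \<noteq> \<zero>\<^bsub>K\<^esub>"
proof -
  interpret F: field F by fact
  obtain d where d: "d \<in> carrier F" "\<And>x. x \<in> carrier F \<Longrightarrow> x \<otimes>\<^bsub>F\<^esub> x \<noteq> d"
    using F.exists_nonsquare[OF assms(2,3)] by auto
  let ?K = "quadratic_extension F d"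
  have "(\<lambda>a. (a, \<zero>\<^bsub>F\<^esub>)) \<in> ring_hom F ?K"
    using d(1) by (intro ring_hom_memI) (auto simp: quadratic_extension_def)
  moreover have "\<one>\<^bsub>?K\<^esub> \<oplus>\<^bsub>?K\<^esub> \<one>\<^bsub>?K\<^esub> \<noteq> \<zero>\<^bsub>?K\<^esub>"
    using assms(3) by (auto simp: quadratic_extension_def)
  moreover have "finite (carrier ?K)" "card (carrier ?K) = card (carrier F) ^ 2"
    using assms(2) by (auto simp: quadratic_extension_def card_cartesian_product power2_eq_square)
  ultimately show ?thesis
    using F.quadratic_extension_field[OF d] unfolding extension_of_degree_def by blast
qed

lemma extension_of_degree_trans:
  assumes "extension_of_degree k F K \<iota>" "extension_of_degree l K L \<kappa>"
  shows "extension_of_degree (k * l) F L (\<kappa> \<circ> \<iota>)"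
  using assms by (auto simp: extension_of_degree_def power_mult intro: ring_hom_trans)

lemma extension_of_degree_eight:
  fixes F :: "('a, 'm) ring_scheme"
  assumes "field F" "finite (carrier F)" "\<one>\<^bsub>F\<^esub> \<oplus>\<^bsub>F\<^esub> \<one>\<^bsub>F\<^esub> \<noteq> \<zero>\<^bsub>F\<^esub>"
  shows "\<exists>(K :: ((('a \<times> 'a) \<times> ('a \<times> 'a)) \<times> (('a \<times> 'a) \<times> ('a \<times> 'a))) ring) \<iota>.
    extension_of_degree 8 F K \<iota> \<and> \<one>\<^bsub>K\<^esub> \<oplus>\<^bsub>K\<^esub> \<one>\<^bsub>K\<^esub> \<noteq> \<zero>\<^bsub>K\<^esub>"
proof -
  obtain K1 :: "('a \<times> 'a) ring" and \<iota>1 where 1: "extension_of_degree 2 F K1 \<iota>1"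
    "\<one>\<^bsub>K1\<^esub> \<oplus>\<^bsub>K1\<^esub> \<one>\<^bsub>K1\<^esub> \<noteq> \<zero>\<^bsub>K1\<^esub>"
    using extension_of_degree_two[OF assms] by (elim exE conjE)
  then have "field K1" "finite (carrier K1)" by (auto simp: extension_of_degree_def)
  from extension_of_degree_two[OF this 1(2)]
  obtain K2 :: "(('a \<times> 'a) \<times> ('a \<times> 'a)) ring" and \<iota>2 where 2: "extension_of_degree 2 K1 K2 \<iota>2"
    "\<one>\<^bsub>K2\<^esub> \<oplus>\<^bsub>K2\<^esub> \<one>\<^bsub>K2\<^esub> \<noteq> \<zero>\<^bsub>K2\<^esub>"
    by (elim exE conjE)
  then have "field K2" "finite (carrier K2)" by (auto simp: extension_of_degree_def)
  from extension_of_degree_two[OF this 2(2)]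
  obtain K3 :: "((('a \<times> 'a) \<times> ('a \<times> 'a)) \<times> (('a \<times> 'a) \<times> ('a \<times> 'a))) ring" and \<iota>3
    where 3: "extension_of_degree 2 K2 K3 \<iota>3" "\<one>\<^bsub>K3\<^esub> \<oplus>\<^bsub>K3\<^esub> \<one>\<^bsub>K3\<^esub> \<noteq> \<zero>\<^bsub>K3\<^esub>"
    by (elim exE conjE)
  from extension_of_degree_trans[OF extension_of_degree_trans[OF 1(1) 2(1)] 3(1)]
  have "extension_of_degree 8 F K3 (\<iota>3 \<circ> (\<iota>2 \<circ> \<iota>1))" by simp
  with 3(2) show ?thesis by blast
qed

section \<open>Subfields of a finite field\<close>

text \<open>The geometric series telescopes after multiplication by \<open>w - 1\<close>, which is
  not a zero divisor. This is the orthogonality of characters behind Fourier inversion.\<close>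

lemma (in domain) sum_powers_root_of_unity:
  assumes w: "w \<in> carrier R" "w [^] (n::nat) = \<one>" "w \<noteq> \<one>"
  shows "(\<Oplus>i\<in>{..<n}. w [^] i) = \<zero>"
proof -
  have "(\<Oplus>i\<in>{..<k}. w [^] i) \<otimes> (w \<ominus> \<one>) = w [^] k \<ominus> \<one>" for k :: nat
  proof (induction k)
    case 0
    then show ?case using w(1) by (simp add: r_neg minus_eq)
  next
    case (Suc k)
    have "(\<Oplus>i\<in>{..<Suc k}. w [^] i) = w [^] k \<oplus> (\<Oplus>i\<in>{..<k}. w [^] i)"
      unfolding lessThan_Suc using w(1) by (intro finsum_insert) auto
    moreover have "(\<Oplus>i\<in>{..<k}. w [^] i) \<in> carrier R" using w(1) by (intro finsum_closed) auto
    moreover have "w [^] k \<otimes> (w \<ominus> \<one>) \<oplus> (w [^] k \<ominus> \<one>) = w [^] k \<otimes> w \<ominus> \<one>"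
    proof -
      have "w [^] k \<in> carrier R" using w(1) by simp
      then show ?thesis using w(1) by algebra
    qed
    ultimately show ?case using w(1) Suc by (simp add: l_distr)
  qed
  from this[of n] have "(\<Oplus>i\<in>{..<n}. w [^] i) \<otimes> (w \<ominus> \<one>) = \<zero>"
    using w(2) by (simp add: r_neg minus_eq)
  moreover have "(\<Oplus>i\<in>{..<n}. w [^] i) \<in> carrier R" using w(1) by (intro finsum_closed) auto
  ultimately show ?thesis using w(1,3) integral_iff[of "\<Oplus>i\<in>{..<n}. w [^] i" "w \<ominus> \<one>"] by auto
qed

locale field_with_generator = field K for K :: "('b, 'k) ring_scheme" (structure) +
  fixes g :: 'b
  assumes finite_K: "finite (carrier K)"
    and g: "g \<in> carrier K" "g \<noteq> \<zero>"
    and generator: "\<And>x. x \<in> carrier K \<Longrightarrow> x \<noteq> \<zero> \<Longrightarrow> \<exists>i::nat. x = g [^] i"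
begin

abbreviation "N \<equiv> card (carrier K) - 1"

lemma N_pos: "N > 0"
proof -
  have "card {\<zero>, \<one>} \<le> card (carrier K)" using finite_K by (intro card_mono) auto
  then show ?thesis by simp
qed

lemma g_power_N: "g [^] N = \<one>"
  by (rule finite_field_power_card[OF finite_K g])

text \<open>The first \<open>N\<close> powers exhaust the \<open>N\<close> nonzero elements, so no
  two of them coincide.\<close>

lemma g_power_inj: "inj_on (\<lambda>i. g [^] i) {..<N}"
proof (rule eq_card_imp_inj_on)
  have "(\<lambda>i. g [^] i) ` {..<N} = carrier K - {\<zero>}"
  proof (intro equalityI subsetI)
    fix x assume "x \<in> carrier K - {\<zero>}"
    with generator obtain i :: nat where "x = g [^] i" by auto
    then have "x = g [^] (i mod N)" using pow_mod[OF g(1) g_power_N] by simp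
    then show "x \<in> (\<lambda>i. g [^] i) ` {..<N}" using N_pos by (intro image_eqI[of _ _ "i mod N"]) simp_all
  qed (use g nat_pow_nonzero in auto)
  then show "card ((\<lambda>i. g [^] i) ` {..<N}) = card {..<N}"
    using finite_K by (simp add: card_Diff_singleton)
qed simp

lemma g_power_eq_one_iff: "g [^] (k::nat) = \<one> \<longleftrightarrow> N dvd k"
proof
  assume "g [^] k = \<one>"
  then have "g [^] (k mod N) = g [^] (0::nat)" using pow_mod[OF g(1) g_power_N] by simp
  then have "k mod N = 0" using N_pos by (intro inj_onD[OF g_power_inj]) simp_all
  then show "N dvd k" by (simp only: dvd_eq_mod_eq_0)
next
  assume "N dvd k"
  then show "g [^] k = \<one>" using pow_mod[OF g(1) g_power_N, of k] by (simp add: dvd_imp_mod_0)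
qed

text \<open>The fixed points of the \<open>r\<close>-th power map form the subfield of order \<open>r\<close>, if \<open>r - 1\<close> divides \<open>N\<close>.\<close>

definition fixed :: "nat \<Rightarrow> 'b set" where
  "fixed r = {x \<in> carrier K. x [^] r = x}"

abbreviation fixed_ring :: "nat \<Rightarrow> ('b, 'k) ring_scheme" where
  "fixed_ring r \<equiv> K\<lparr>carrier := fixed r\<rparr>"

text \<open>Unit groups see only the multiplication, and the fixed points of a power map are closed
  under products, whatever \<open>r\<close> is.\<close>

lemma monoid_fixed: "monoid (fixed_ring r)"
  by (rule monoidI) (auto simp: fixed_def nat_pow_distrib m_assoc)

text \<open>A nonzero fixed point is a solution of \<open>x ^ (r - 1) = 1\<close>. In a cyclic group
  of order \<open>N = c (r - 1)\<close> generated by \<open>g\<close> these are the powers of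
  \<open>g ^ c\<close>.\<close>

lemma fixed_nonzero:
  assumes "1 < r" "(r - 1) dvd N"
  shows "bij_betw (\<lambda>j. g [^] (N div (r - 1) * j)) {..<r - 1} (fixed r - {\<zero>})"
proof -
  define c where "c = N div (r - 1)"
  have c1: "N = c * (r - 1)" using assms(2) by (simp add: c_def)
  moreover have "c > 0" using c1 N_pos by (cases "c = 0") simp_all
  ultimately have c: "N = c * (r - 1)" "c > 0" .
  have "inj_on (\<lambda>j. g [^] (c * j)) {..<r - 1}"
  proof (rule inj_onI)
    fix i j assume ij: "i \<in> {..<r - 1}" "j \<in> {..<r - 1}" "g [^] (c * i) = g [^] (c * j)"
    have "c * i < N" "c * j < N" using ij(1,2) c by simp_all
    then have "c * i = c * j" using ij(3) by (intro inj_onD[OF g_power_inj]) simp_all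
    then show "i = j" using c(2) by simp
  qed
  moreover have "(\<lambda>j. g [^] (c * j)) ` {..<r - 1} = fixed r - {\<zero>}"
  proof (intro equalityI subsetI)
    fix x assume "x \<in> (\<lambda>j. g [^] (c * j)) ` {..<r - 1}"
    then obtain j where x: "x = g [^] (c * j)" by blast
    have "x \<in> carrier K" "x \<noteq> \<zero>" using g nat_pow_nonzero by (simp_all add: x)
    have "x [^] (r - 1) = \<one>"
      unfolding x nat_pow_pow[OF g(1)] g_power_eq_one_iff c(1) by (intro mult_dvd_mono) simp_all
    then have "x [^] Suc (r - 1) = x" using \<open>x \<in> carrier K\<close> by simp
    then show "x \<in> fixed r - {\<zero>}" using assms(1) \<open>x \<in> carrier K\<close> \<open>x \<noteq> \<zero>\<close> by (simp add: fixed_def)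
  next
    fix x assume "x \<in> fixed r - {\<zero>}"
    then have x: "x \<in> carrier K" "x [^] Suc (r - 1) = x" "x \<noteq> \<zero>"
      using assms(1) by (simp_all add: fixed_def)
    from generator[OF x(1,3)] obtain i :: nat where i: "x = g [^] i" by (rule exE)
    have "x [^] (r - 1) = \<one>"
      using x m_rcancel[of x "x [^] (r - 1)" \<one>] by simp
    then have "c * (r - 1) dvd i * (r - 1)"
      unfolding i nat_pow_pow[OF g(1)] g_power_eq_one_iff c(1) .
    then have "c dvd i" using assms(1) by simp
    then obtain j where j: "i = c * j" by (rule dvdE)
    have "x = g [^] (c * j mod N)" using pow_mod[OF g(1) g_power_N] i j by simp
    also have "c * j mod N = c * (j mod (r - 1))" unfolding c(1) by (rule mult_mod_right[symmetric])
    finally show "x \<in> (\<lambda>j. g [^] (c * j)) ` {..<r - 1}"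
      using assms(1) by (intro image_eqI[of _ _ "j mod (r - 1)"]) simp_all
  qed
  ultimately show ?thesis by (simp add: bij_betw_def c_def)
qed

lemma card_fixed:
  assumes "1 < r" "(r - 1) dvd N"
  shows "card (fixed r) = r"
proof -
  have "\<zero> \<in> fixed r" using assms(1) by (simp add: fixed_def nat_pow_zero)
  moreover have "finite (fixed r)" using finite_K by (simp add: fixed_def)
  moreover have "card (fixed r - {\<zero>}) = r - 1"
    using bij_betw_same_card[OF fixed_nonzero[OF assms]] by simp
  ultimately show ?thesis using assms(1) card_Suc_Diff1[of "fixed r" \<zero>] by simp
qed

lemma Units_fixed:
  assumes "1 < r"
  shows "Units (fixed_ring r) = fixed r - {\<zero>}"
proof (intro equalityI subsetI)
  fix x assume "x \<in> Units (fixed_ring r)"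
  then show "x \<in> fixed r - {\<zero>}" by (auto simp: Units_def fixed_def)
next
  fix x assume "x \<in> fixed r - {\<zero>}"
  then have x: "x \<in> fixed r" "x \<in> carrier K" "x \<noteq> \<zero>" "x [^] r = x" by (auto simp: fixed_def)
  have u: "x \<in> Units K" using x field_Units by simp
  have "(inv x) [^] r \<otimes> x = (inv x) [^] r \<otimes> x [^] r" using x(4) by simp
  also have "\<dots> = (inv x \<otimes> x) [^] r" using x(2) u by (intro nat_pow_distrib[symmetric]) simp_all
  also have "\<dots> = \<one>" using u by simp
  finally have "(inv x) [^] r = inv x"
    using x u m_rcancel[of x "(inv x) [^] r" "inv x"] by simp
  then have "inv x \<in> fixed r" using u by (simp add: fixed_def)
  moreover have "inv x \<otimes> x = \<one>" "x \<otimes> inv x = \<one>" using u by simp_all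
  ultimately show "x \<in> Units (fixed_ring r)"
    using x(1) by (auto simp: Units_def intro!: bexI[of _ "inv x"])
qed

lemma units_of_fixed:
  assumes "1 < r" "(r - 1) dvd N"
  shows "units_of (fixed_ring r) \<cong> integer_mod_group (r - 1)"
proof (rule group.iso_sym[OF group_integer_mod_group], rule is_isoI, rule isoI)
  let ?c = "N div (r - 1)"
  have Z: "carrier (integer_mod_group (r - 1)) = {0..<int (r - 1)}"
    using assms(1) by (simp add: carrier_integer_mod_group)
  have c: "N = ?c * (r - 1)" using assms(2) by simp
  have nat: "bij_betw nat {0..<int (r - 1)} {..<r - 1}"
    by (rule bij_betw_byWitness[where f' = int]) auto
  let ?h = "(\<lambda>j. g [^] (?c * j)) \<circ> nat"
  show "bij_betw ?h (carrier (integer_mod_group (r - 1))) (carrier (units_of (fixed_ring r)))"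
    unfolding Z units_of_carrier Units_fixed[OF assms(1)]
    by (rule bij_betw_trans[OF nat fixed_nonzero[OF assms]])
  show "?h \<in> hom (integer_mod_group (r - 1)) (units_of (fixed_ring r))"
  proof (rule homI)
    fix a assume "a \<in> carrier (integer_mod_group (r - 1))"
    then show "?h a \<in> carrier (units_of (fixed_ring r))"
      using \<open>bij_betw ?h _ _\<close> by (rule bij_betwE[rule_format, rotated])
    fix b assume "b \<in> carrier (integer_mod_group (r - 1))"
    with \<open>a \<in> _\<close> have ab: "0 \<le> a" "0 \<le> b" unfolding Z by simp_all
    have "?c * ((nat a + nat b) mod (r - 1)) = (?c * (nat a + nat b)) mod N"
      by (subst (2) c) (rule mult_mod_right)
    then have "g [^] (?c * ((nat a + nat b) mod (r - 1))) = g [^] (?c * nat a + ?c * nat b)"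
      using pow_mod[OF g(1) g_power_N] by (simp add: distrib_left)
    moreover have "nat ((a + b) mod int (r - 1)) = (nat a + nat b) mod (r - 1)"
      using ab by (simp only: nat_mod_distrib add_nonneg_nonneg of_nat_0_le_iff nat_add_distrib nat_int)
    ultimately show "?h (a \<otimes>\<^bsub>integer_mod_group (r - 1)\<^esub> b) = ?h a \<otimes>\<^bsub>units_of (fixed_ring r)\<^esub> ?h b"
      using g(1) by (simp add: units_of_mult nat_pow_mult)
  qed
qed

end

section \<open>Fourier transform on the residues modulo 32\<close>

lemma (in cring) frobenius_finsum:
  fixes p :: nat
  assumes p: "Factorial_Ring.prime p" "[p] \<cdot> \<one> = \<zero>" and f: "\<And>x. x \<in> S \<Longrightarrow> f x \<in> carrier R"
  shows "(\<Oplus>x\<in>S. f x) [^] (p ^ k) = (\<Oplus>x\<in>S. f x [^] (p ^ k))"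
  using f
proof (induction S rule: infinite_finite_induct)
  \<comment> \<open>A sum over an infinite set is zero by convention, and so is its power.\<close>
  case (infinite S)
  then show ?case using p(1) by (simp add: nat_pow_zero prime_gt_0_nat)
next
  case empty
  then show ?case using p(1) by (simp add: nat_pow_zero prime_gt_0_nat)
next
  case (insert x S)
  have "f x \<in> carrier R" "(\<Oplus>x\<in>S. f x) \<in> carrier R"
    using insert.prems by (auto intro: finsum_closed)
  then show ?case
    using insert by (simp add: frobenius_power_add[OF p])
qed

lemma power_minus_one_dvd:
  fixes q :: nat
  assumes "d dvd k" "q > 0"
  shows "q ^ d - 1 dvd q ^ k - 1"
proof -
  obtain m where m: "k = d * m" using assms(1) by (rule dvdE)
  \<comment> \<open>In the integers the geometric factorization is not disturbed by truncated
    subtraction.\<close>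
  have "int q ^ d - 1 dvd (int q ^ d) ^ m - 1" by (simp add: power_diff_1_eq)
  then have "int (q ^ d - 1) dvd int (q ^ k - 1)"
    using assms(2) by (simp add: m of_nat_diff power_mult Suc_le_eq)
  then show ?thesis by (simp only: of_nat_dvd_iff)
qed

text \<open>An odd square is 1 modulo 8, because \<open>m * (m + 1)\<close> is even, and each
  further squaring gains a factor 2.\<close>

lemma odd_power_eight_mod: "odd q \<Longrightarrow> q ^ 8 mod 32 = (1::nat)"
proof -
  assume q: "odd q"
  then obtain m where m: "q = 2 * m + 1" by (rule oddE)
  have "even (m * (m + 1))" by simp
  then obtain s where "m * (m + 1) = 2 * s" by (rule dvdE)
  then have s: "q ^ 2 = 8 * s + 1" by (simp add: m power2_eq_square algebra_simps)
  have "q ^ 8 = (q ^ 2) ^ 4" by simp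
  also have "\<dots> = 32 * (128 * s ^ 4 + 64 * s ^ 3 + 12 * s ^ 2 + s) + 1"
    unfolding s by (simp add: algebra_simps power4_eq_xxxx power3_eq_cube power2_eq_square)
  finally have "q ^ 8 = 1 + 32 * (128 * s ^ 4 + 64 * s ^ 3 + 12 * s ^ 2 + s)" by simp
  then show ?thesis by (simp only: mod_mult_self2) simp
qed

locale fourier = field_with_generator K g + F: field F + FG: finite_group_algebra F "integer_mod_group 32"
  for K :: "('b, 'k) ring_scheme" (structure) and g and F :: "('a, 'm) ring_scheme" +
  fixes \<iota> :: "'a \<Rightarrow> 'b" and p n :: nat
  assumes iota: "\<iota> \<in> ring_hom F K" and finite_F: "finite (carrier F)"
    and card_F: "card (carrier F) = p ^ n" and card_K: "card (carrier K) = card (carrier F) ^ 8"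
    and p: "Factorial_Ring.prime p" "[p] \<cdot> \<one> = \<zero>" and odd: "odd p" and n: "n > 0"
begin

abbreviation "q \<equiv> p ^ n"
definition \<zeta> :: 'b where "\<zeta> = g [^] (N div 32)"
abbreviation "Z \<equiv> integer_mod_group 32"

sublocale hom: ring_hom_cring F K \<iota>
  using iota by unfold_locales

lemma Z_carrier: "carrier Z = {0..<32}"
  by (simp add: carrier_integer_mod_group)

lemma iota_inj: "inj_on \<iota> (carrier F)"
proof (rule inj_onI)
  fix a b assume ab: "a \<in> carrier F" "b \<in> carrier F" "\<iota> a = \<iota> b"
  show "a = b"
  proof (rule ccontr)
    assume "a \<noteq> b"
    define c where "c = a \<ominus>\<^bsub>F\<^esub> b"
    have c: "c \<in> carrier F" "c \<noteq> \<zero>\<^bsub>F\<^esub>" using ab \<open>a \<noteq> b\<close> by (simp_all add: c_def)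
    have "\<iota> c = \<zero>" using ab by (simp add: c_def F.minus_eq r_neg)
    moreover have "c \<otimes>\<^bsub>F\<^esub> inv\<^bsub>F\<^esub> c = \<one>\<^bsub>F\<^esub>" "inv\<^bsub>F\<^esub> c \<in> carrier F" using c F.field_Units by auto
    then have "\<iota> c \<otimes> \<iota> (inv\<^bsub>F\<^esub> c) = \<one>" using c(1) by (simp flip: hom.hom_mult)
    ultimately show False using \<open>inv\<^bsub>F\<^esub> c \<in> carrier F\<close> by simp
  qed
qed

lemma iota_power_q: "a \<in> carrier F \<Longrightarrow> \<iota> a [^] q = \<iota> a"
proof (cases "a = \<zero>\<^bsub>F\<^esub>")
  case True
  then show ?thesis using p(1) by (simp add: nat_pow_zero prime_gt_0_nat)
next
  case False
  assume a: "a \<in> carrier F"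
  have "a [^]\<^bsub>F\<^esub> (q - 1) = \<one>\<^bsub>F\<^esub>" using F.finite_field_power_card[OF finite_F a False] by (simp add: card_F)
  then have "a [^]\<^bsub>F\<^esub> Suc (q - 1) = a" using a by simp
  then have "a [^]\<^bsub>F\<^esub> q = a" using p(1) by (simp add: prime_gt_0_nat)
  then show ?thesis using a by (simp flip: hom.hom_pow)
qed

lemma N_eq: "N = q ^ 8 - 1"
  by (simp add: card_K card_F)

lemma dvd_N: "d dvd 8 \<Longrightarrow> q ^ d - 1 dvd N"
  unfolding N_eq using p(1) by (intro power_minus_one_dvd) (simp_all add: prime_gt_0_nat)

lemma one_less_power_q: "d > 0 \<Longrightarrow> 1 < q ^ d"
  using one_less_power[OF prime_gt_1_nat[OF p(1)], of "n * d"] n by (simp add: power_mult)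

lemma zeta_closed [simp]: "\<zeta> \<in> carrier K"
  using g by (simp add: \<zeta>_def)

text \<open>Since 32 divides \<open>N\<close>, the power \<open>\<zeta>\<close> of the generator has
  order exactly 32.\<close>

lemma zeta_power_eq_one_iff: "\<zeta> [^] (k::nat) = \<one> \<longleftrightarrow> 32 dvd k"
proof -
  have "q ^ 8 mod 32 = 1" using odd by (intro odd_power_eight_mod) simp
  then have "N = 32 * (q ^ 8 div 32)" unfolding N_eq using div_mult_mod_eq[of "q ^ 8" 32] by simp
  then have c: "N = N div 32 * 32" "N div 32 > 0" using N_pos by (simp_all add: dvd_div_eq_0_iff)
  have "\<zeta> [^] k = \<one> \<longleftrightarrow> N dvd N div 32 * k"
    unfolding \<zeta>_def nat_pow_pow[OF g(1)] by (rule g_power_eq_one_iff)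
  also have "\<dots> \<longleftrightarrow> N div 32 * 32 dvd N div 32 * k" using c(1) by simp
  also have "\<dots> \<longleftrightarrow> 32 dvd k" using c(2) by (rule nat_mult_dvd_cancel1)
  finally show ?thesis .
qed

lemma zeta_power_mod: "\<zeta> [^] (k mod 32) = \<zeta> [^] (k::nat)"
  by (rule pow_mod) (simp_all add: zeta_power_eq_one_iff del: nat_pow_Suc)

lemma zeta_power_cong: "k mod 32 = l mod 32 \<Longrightarrow> \<zeta> [^] k = \<zeta> [^] (l::nat)"
  using zeta_power_mod[of k] zeta_power_mod[of l] by simp

text \<open>The value of the polynomial \<open>f\<close> at \<open>\<zeta> ^ r\<close>. Natural
  numbers rather than residues serve as indices, so that \<open>q ^ t * r\<close> can be written
  without reduction.\<close>

definition transform :: "nat \<Rightarrow> (int \<Rightarrow> 'a) \<Rightarrow> 'b" where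
  "transform r f = (\<Oplus>x\<in>carrier Z. \<iota> (f x) \<otimes> \<zeta> [^] (r * nat x))"

lemma transform_closed: "f \<in> carrier FG.A \<Longrightarrow> transform r f \<in> carrier K"
  unfolding transform_def by (intro finsum_closed) (auto simp: FG.coeff_closed)

lemma transform_mod:
  assumes "r mod 32 = s mod 32"
  shows "transform r f = transform s f"
proof -
  have "\<zeta> [^] (r * nat x) = \<zeta> [^] (s * nat x)" for x
    by (rule zeta_power_cong) (rule mod_mult_cong[OF assms refl])
  then show ?thesis by (simp add: transform_def)
qed

text \<open>Raising to the power \<open>q\<close> is additive in \<open>K\<close>, fixes the
  coefficients coming from \<open>F\<close>, and turns \<open>\<zeta> ^ r\<close> into
  \<open>\<zeta> ^ (q r)\<close>.\<close>

lemma transform_power: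
  assumes f: "f \<in> carrier FG.A"
  shows "transform r f [^] (q ^ t) = transform (q ^ t * r) f"
proof (induction t)
  case 0
  then show ?case using transform_closed[OF f] by (simp add: nat_pow_eone)
next
  case (Suc t)
  have c: "\<iota> (f x) \<in> carrier K" if "x \<in> carrier Z" for x
    using FG.coeff_closed[OF f that] by simp
  have "transform s f [^] q = transform (q * s) f" for s
  proof -
    have "transform s f [^] q = (\<Oplus>x\<in>carrier Z. (\<iota> (f x) \<otimes> \<zeta> [^] (s * nat x)) [^] q)"
      unfolding transform_def using c by (intro frobenius_finsum p) simp
    also have "\<dots> = transform (q * s) f"
      unfolding transform_def using c FG.coeff_closed[OF f]
      by (intro finsum_cong' refl)
        (auto simp: nat_pow_distrib iota_power_q nat_pow_pow[OF zeta_closed] mult_ac)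
    finally show ?thesis .
  qed
  then have "transform (q * (q ^ t * r)) f = (transform r f [^] (q ^ t)) [^] q"
    using Suc by simp
  then show ?case using transform_closed[OF f] by (simp add: nat_pow_pow mult_ac)
qed

lemma transform_mult:
  assumes f: "f \<in> carrier FG.A" and h: "h \<in> carrier FG.A"
  shows "transform r (f \<otimes>\<^bsub>FG.A\<^esub> h) = transform r f \<otimes> transform r h"
  unfolding transform_def
proof (rule FG.character_sum_mult[OF is_cring iota _ _ f h])
  fix x y assume "x \<in> carrier Z" "y \<in> carrier Z"
  then have xy: "0 \<le> x" "0 \<le> y" by (simp_all add: Z_carrier)
  have "r * nat ((x + y) mod 32) mod 32 = (r * nat x + r * nat y) mod 32"
    using xy by (simp add: nat_mod_distrib nat_add_distrib mod_mult_right_eq distrib_left[symmetric])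
  then show "\<zeta> [^] (r * nat (x \<otimes>\<^bsub>Z\<^esub> y)) = \<zeta> [^] (r * nat x) \<otimes> \<zeta> [^] (r * nat y)"
    unfolding nat_pow_mult[OF zeta_closed] by (intro zeta_power_cong) simp
qed simp

lemma transform_one: "transform r \<one>\<^bsub>FG.A\<^esub> = \<one>"
proof -
  have "transform r \<one>\<^bsub>FG.A\<^esub> = (\<Oplus>x\<in>carrier Z. if x = 0 then \<one> else \<zero>)"
    unfolding transform_def
    by (intro finsum_cong' refl) (auto simp: FG.one_A FG.single_def)
  also have "\<dots> = \<one>"
    by (intro add.finprod_singleton_swap[where f = "\<lambda>_. \<one>"]) (auto simp: Z_carrier)
  finally show ?thesis .
qed

text \<open>\<open>p\<close> and 32 are coprime; if both vanished in \<open>K\<close>, a linear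
  combination of them would give \<open>1 = 0\<close>. Fourier inversion may therefore divide by
  32.\<close>

lemma thirty_two_neq_zero: "[(32::nat)] \<cdot> \<one> \<noteq> \<zero>"
proof
  assume z: "[(32::nat)] \<cdot> \<one> = \<zero>"
  have "coprime p (2 ^ 5)" using odd unfolding coprime_power_right_iff coprime_right_2_iff_odd by simp
  then have "coprime p 32" by simp
  then have "\<exists>x. [p * x = Suc 0] (mod 32)" by (rule cong_solve_coprime_nat)
  then obtain x where "[p * x = Suc 0] (mod 32)" by (rule exE)
  then have "p * x mod 32 = 1" by (simp add: cong_def)
  then have x: "p * x = 32 * (p * x div 32) + 1" using div_mult_mod_eq[of "p * x" 32] by simp
  have "\<zero> = [(p * x)] \<cdot> \<one>" by (rule add_pow_eq_zero[OF p(2), symmetric]) simp_all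
  also have "\<dots> = [(32 * (p * x div 32))] \<cdot> \<one> \<oplus> [(1::nat)] \<cdot> \<one>"
    unfolding add.nat_pow_mult[OF one_closed] using x by simp
  also have "\<dots> = \<one>" using add_pow_eq_zero[OF z, of "32 * (p * x div 32)" \<one>] by simp
  finally show False by simp
qed

text \<open>The exponent \<open>32 - nat h\<close> represents \<open>- h\<close> without leaving the
  naturals. After exchanging the sums, the powers of \<open>\<zeta> ^ (x - h)\<close> add up to 32
  for \<open>x = h\<close> and to zero otherwise.\<close>

lemma transform_inversion:
  assumes f: "f \<in> carrier FG.A" and h: "h \<in> carrier Z"
  shows "(\<Oplus>i\<in>{..<32::nat}. \<zeta> [^] (i * (32 - nat h)) \<otimes> transform i f) = \<iota> (f h) \<otimes> [(32::nat)] \<cdot> \<one>"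
proof -
  have c: "\<iota> (f x) \<in> carrier K" if "x \<in> carrier Z" for x
    using FG.coeff_closed[OF f that] by simp
  have fin: "finite (carrier Z)" by (simp add: Z_carrier)
  let ?w = "\<lambda>x. \<zeta> [^] (32 - nat h + nat x)"
  have "(\<Oplus>i\<in>{..<32::nat}. \<zeta> [^] (i * (32 - nat h)) \<otimes> transform i f)
      = (\<Oplus>i\<in>{..<32::nat}. \<Oplus>x\<in>carrier Z. \<iota> (f x) \<otimes> ?w x [^] i)"
  proof (intro finsum_cong' refl)
    fix i :: nat
    have "\<zeta> [^] (i * (32 - nat h)) \<otimes> transform i f
        = (\<Oplus>x\<in>carrier Z. \<zeta> [^] (i * (32 - nat h)) \<otimes> (\<iota> (f x) \<otimes> \<zeta> [^] (i * nat x)))"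
      unfolding transform_def using c fin by (intro finsum_rdistr) auto
    also have "\<dots> = (\<Oplus>x\<in>carrier Z. \<iota> (f x) \<otimes> ?w x [^] i)"
    proof (intro finsum_cong' refl)
      fix x assume x: "x \<in> carrier Z"
      have "\<zeta> [^] (i * (32 - nat h)) \<otimes> (\<iota> (f x) \<otimes> \<zeta> [^] (i * nat x))
          = \<iota> (f x) \<otimes> (\<zeta> [^] (i * (32 - nat h)) \<otimes> \<zeta> [^] (i * nat x))"
        using c[OF x] by (simp add: m_lcomm del: nat_pow_pow)
      also have "\<zeta> [^] (i * (32 - nat h)) \<otimes> \<zeta> [^] (i * nat x) = ?w x [^] i"
        unfolding nat_pow_mult[OF zeta_closed] nat_pow_pow[OF zeta_closed]
        by (simp only: distrib_left mult.commute)
      finally show "\<zeta> [^] (i * (32 - nat h)) \<otimes> (\<iota> (f x) \<otimes> \<zeta> [^] (i * nat x)) = \<iota> (f x) \<otimes> ?w x [^] i" .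
    qed (use c in auto)
    finally show "\<zeta> [^] (i * (32 - nat h)) \<otimes> transform i f = (\<Oplus>x\<in>carrier Z. \<iota> (f x) \<otimes> ?w x [^] i)" .
  qed (use c in \<open>auto intro!: finsum_closed\<close>)
  also have "\<dots> = (\<Oplus>x\<in>carrier Z. \<Oplus>i\<in>{..<32::nat}. \<iota> (f x) \<otimes> ?w x [^] i)"
    using c fin by (intro finsum_swap) auto
  also have "\<dots> = (\<Oplus>x\<in>carrier Z. if x = h then \<iota> (f x) \<otimes> [(32::nat)] \<cdot> \<one> else \<zero>)"
  proof (intro finsum_cong' refl)
    fix x assume x: "x \<in> carrier Z"
    have eq: "(\<Oplus>i\<in>{..<32::nat}. \<iota> (f x) \<otimes> ?w x [^] i) = \<iota> (f x) \<otimes> (\<Oplus>i\<in>{..<32::nat}. ?w x [^] i)"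
      using c[OF x] by (intro finsum_rdistr[symmetric]) auto
    \<comment> \<open>The number lies strictly between 0 and 64, so the only multiple of 32 it can
      equal is 32 itself.\<close>
    have iff: "32 dvd 32 - nat h + nat x \<longleftrightarrow> x = h"
    proof
      assume "32 dvd 32 - nat h + nat x"
      then obtain k where k: "32 - nat h + nat x = 32 * k" by (rule dvdE)
      moreover have "nat h < 32" "nat x < 32" using h x by (auto simp: Z_carrier nat_less_iff)
      ultimately have "k > 0" "k < 2" by linarith+
      then have "k = 1" by simp
      with k \<open>nat h < 32\<close> have "nat x = nat h" by simp
      then show "x = h" using h x by (auto simp: Z_carrier eq_nat_nat_iff)
    next
      assume "x = h"
      moreover have "nat h \<le> 32" using h by (auto simp: Z_carrier nat_le_iff)
      ultimately show "32 dvd 32 - nat h + nat x" by simp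
    qed
    show "(\<Oplus>i\<in>{..<32::nat}. \<iota> (f x) \<otimes> ?w x [^] i) = (if x = h then \<iota> (f x) \<otimes> [(32::nat)] \<cdot> \<one> else \<zero>)"
    proof (cases "x = h")
      case True
      then have "?w x = \<one>" using iff unfolding zeta_power_eq_one_iff by blast
      then have "(\<Oplus>i\<in>{..<32::nat}. ?w x [^] i) = [(32::nat)] \<cdot> \<one>"
        using add.finprod_const[of \<one> "{..<32::nat}"] by simp
      then show ?thesis using eq True by simp
    next
      case False
      then have "?w x \<noteq> \<one>" using iff unfolding zeta_power_eq_one_iff by blast
      moreover have "?w x [^] (32::nat) = \<one>"
        unfolding nat_pow_pow[OF zeta_closed] zeta_power_eq_one_iff by simp
      ultimately have "(\<Oplus>i\<in>{..<32::nat}. ?w x [^] i) = \<zero>"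
        by (intro sum_powers_root_of_unity) simp_all
      then show ?thesis using eq False c[OF x] by simp
    qed
  qed (use c in auto)
  also have "\<dots> = \<iota> (f h) \<otimes> [(32::nat)] \<cdot> \<one>"
    using h c fin by (intro add.finprod_singleton_swap) auto
  finally show ?thesis .
qed

lemma transform_inj:
  assumes f: "f \<in> carrier FG.A" and h: "h \<in> carrier FG.A"
    and eq: "\<And>i. i < 32 \<Longrightarrow> transform i f = transform i h"
  shows "f = h"
proof (rule FG.A_eqI[OF f h])
  fix x assume x: "x \<in> carrier Z"
  have "(\<Oplus>i\<in>{..<32::nat}. \<zeta> [^] (i * (32 - nat x)) \<otimes> transform i f)
      = (\<Oplus>i\<in>{..<32::nat}. \<zeta> [^] (i * (32 - nat x)) \<otimes> transform i h)"
    using transform_closed[OF h] by (intro finsum_cong' refl) (auto simp: eq)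
  then have "\<iota> (f x) \<otimes> [(32::nat)] \<cdot> \<one> = \<iota> (h x) \<otimes> [(32::nat)] \<cdot> \<one>"
    by (simp only: transform_inversion[OF f x] transform_inversion[OF h x])
  then have "\<iota> (f x) = \<iota> (h x)"
    using m_rcancel[OF thirty_two_neq_zero add.nat_pow_closed[OF one_closed]
        hom.hom_closed[OF FG.coeff_closed[OF f x]] hom.hom_closed[OF FG.coeff_closed[OF h x]]]
    by (rule iffD1[rotated])
  then show "f x = h x"
    by (rule inj_onD[OF iota_inj _ FG.coeff_closed[OF f x] FG.coeff_closed[OF h x]])
qed

text \<open>A list \<open>ds\<close> of pairs (representative, length) of the orbits of multiplication by \<open>q\<close> on
  the residues modulo 32.\<close>

lemma units_iso_orbits:
  assumes ds: "\<And>r d. (r, d) \<in> set ds \<Longrightarrow> d dvd 8 \<and> (q ^ d * r) mod 32 = r mod 32"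
    and cover: "\<And>i. i < 32 \<Longrightarrow> \<exists>(r, d) \<in> set ds. \<exists>t. i = (q ^ t * r) mod 32"
    and sum: "sum_list (map snd ds) = 32"
  shows "units_of FG.A \<cong> product_group {..<length ds} (\<lambda>j. integer_mod_group (p ^ (snd (ds ! j) * n) - 1))"
proof -
  define L where "L = {..<length ds}"
  define rep len where "rep j = fst (ds ! j)" and "len j = snd (ds ! j)" for j
  have nth: "len j dvd 8" "len j > 0" "(q ^ len j * rep j) mod 32 = rep j mod 32" if "j \<in> L" for j
  proof -
    have "(rep j, len j) \<in> set ds" using that by (simp add: L_def rep_def len_def)
    from ds[OF this] show "len j dvd 8" "(q ^ len j * rep j) mod 32 = rep j mod 32" by simp_all
    then show "len j > 0" by (intro Nat.gr0I) simp
  qed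
  \<comment> \<open>The two premises of the results on \<open>fixed\<close>, with
    \<open>q ^ len j\<close> as the order of the subfield.\<close>
  note r = one_less_power_q[OF nth(2)] dvd_N[OF nth(1)]
  define \<Phi> where "\<Phi> f = (\<lambda>j\<in>L. transform (rep j) f)" for f
  let ?P = "product_group L (\<lambda>j. fixed_ring (q ^ len j))"
  have \<Phi>_closed: "\<Phi> f \<in> carrier ?P" if "f \<in> carrier FG.A" for f
  proof -
    have "transform (rep j) f \<in> fixed (q ^ len j)" if "j \<in> L" for j
      using transform_closed[OF \<open>f \<in> _\<close>] transform_power[OF \<open>f \<in> _\<close>] transform_mod[OF nth(3)[OF that]]
      by (simp add: fixed_def)
    then show ?thesis by (simp add: \<Phi>_def)
  qed
  have inj: "inj_on \<Phi> (carrier FG.A)"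
  proof (rule inj_onI, rule transform_inj)
    fix f h and i :: nat assume fh: "f \<in> carrier FG.A" "h \<in> carrier FG.A" "\<Phi> f = \<Phi> h" and i: "i < 32"
    from cover[OF i] obtain r d t where rd: "(r, d) \<in> set ds" "i = (q ^ t * r) mod 32" by auto
    then obtain j where j: "j \<in> L" "rep j = r" by (auto simp: in_set_conv_nth L_def rep_def)
    have "transform r f = transform r h" using fun_cong[OF fh(3), of j] j by (simp add: \<Phi>_def)
    then have "transform (q ^ t * r) f = transform (q ^ t * r) h"
      by (simp flip: transform_power[OF fh(1)] transform_power[OF fh(2)])
    then show "transform i f = transform i h"
      using transform_mod[of i "q ^ t * r"] rd(2) by simp
  qed simp_all
  have "card (carrier ?P) = (\<Prod>j\<in>L. card (fixed (q ^ len j)))"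
    by (simp add: L_def card_PiE)
  also have "\<dots> = (\<Prod>j\<in>L. q ^ len j)" by (intro prod.cong refl card_fixed r)
  also have "\<dots> = q ^ (\<Sum>j\<in>L. len j)" by (simp add: power_sum)
  also have "(\<Sum>j\<in>L. len j) = 32"
    using sum by (simp add: sum_list_sum_nth L_def len_def atLeast0LessThan)
  finally have card_P: "card (carrier ?P) = q ^ 32" .
  have "finite (carrier ?P)"
    using finite_K by (auto simp: L_def fixed_def intro!: finite_PiE)
  moreover have "card (\<Phi> ` carrier FG.A) = q ^ 32"
    using card_image[OF inj] FG.card_A[OF finite_F] by (simp add: Z_carrier card_F)
  ultimately have img: "\<Phi> ` carrier FG.A = carrier ?P"
    using \<Phi>_closed card_P by (intro card_subset_eq) auto
  have "units_of FG.A \<cong> units_of ?P"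
  proof (rule units_of_iso)
    show "\<Phi> \<in> hom FG.A ?P"
    proof (rule homI)
      fix f h assume fh: "f \<in> carrier FG.A" "h \<in> carrier FG.A"
      show "\<Phi> f \<in> carrier ?P" by (rule \<Phi>_closed[OF fh(1)])
      show "\<Phi> (f \<otimes>\<^bsub>FG.A\<^esub> h) = \<Phi> f \<otimes>\<^bsub>?P\<^esub> \<Phi> h"
        by (simp add: \<Phi>_def transform_mult[OF fh] fun_eq_iff)
    qed
    show "bij_betw \<Phi> (carrier FG.A) (carrier ?P)" using inj img by (simp add: bij_betw_def)
    show "\<Phi> \<one>\<^bsub>FG.A\<^esub> = \<one>\<^bsub>?P\<^esub>" by (simp add: \<Phi>_def transform_one)
  qed simp_all
  also have "units_of ?P = product_group L (\<lambda>j. units_of (fixed_ring (q ^ len j)))"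
    by (rule units_of_product_group)
  also have "\<dots> \<cong> product_group L (\<lambda>j. integer_mod_group (q ^ len j - 1))"
  proof (rule iso_product_groupI)
    show "units_of (fixed_ring (q ^ len j)) \<cong> integer_mod_group (q ^ len j - 1)" if "j \<in> L" for j
      by (rule units_of_fixed[OF r(1)[OF that] r(2)[OF that]])
  qed (simp_all add: monoid.units_group[OF monoid_fixed])
  also have "(\<lambda>j. integer_mod_group (q ^ len j - 1)) = (\<lambda>j. integer_mod_group (p ^ (snd (ds ! j) * n) - 1))"
    by (simp add: len_def mult.commute flip: power_mult)
  finally show ?thesis by (simp add: L_def)
qed

end

section \<open>Orbits of multiplication by the order of the field\<close>

text \<open>Neither disjointness of the orbits nor minimality of the lengths is demanded: segments
  of total length 32 that cover all 32 residues leave no room for repetition. For a numeral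
  \<open>c\<close> every condition can be decided by computation.\<close>

definition orbits_mod_32 :: "nat \<Rightarrow> (nat \<times> nat) list \<Rightarrow> bool" where
  "orbits_mod_32 c ds \<longleftrightarrow>
    list_all (\<lambda>(r, d). d \<in> {1, 2, 4, 8} \<and> c ^ d * r mod 32 = r mod 32) ds \<and>
    set [0..<32] \<subseteq> set (concat (map (\<lambda>(r, d). map (\<lambda>t. c ^ t * r mod 32) [0..<d]) ds)) \<and>
    sum_list (map snd ds) = 32"

text \<open>From case to case only the residue \<open>c\<close> and the list \<open>ds\<close> vary;
  \<open>H\<close> is the form in which the theorem writes the product.\<close>

lemma units_group_algebra_odd:
  fixes F :: "('a, 'm) ring_scheme" and p n :: nat
  assumes "field F" and fin: "finite (carrier F)" and p: "Factorial_Ring.prime p" "[p] \<cdot>\<^bsub>F\<^esub> \<one>\<^bsub>F\<^esub> = \<zero>\<^bsub>F\<^esub>"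
    and odd: "odd p" and card: "card (carrier F) = p ^ n" and n: "n > 0"
    and c: "p ^ n mod 32 = c" and ds: "orbits_mod_32 c ds"
    and H: "product_group {..<length ds} (\<lambda>j. integer_mod_group (p ^ (snd (ds ! j) * n) - 1)) \<cong> H"
  shows "units_of (group_algebra F (integer_mod_group 32)) \<cong> H"
proof -
  interpret F: field F by fact
  have "\<one>\<^bsub>F\<^esub> \<oplus>\<^bsub>F\<^esub> \<one>\<^bsub>F\<^esub> \<noteq> \<zero>\<^bsub>F\<^esub>"
  proof
    assume "\<one>\<^bsub>F\<^esub> \<oplus>\<^bsub>F\<^esub> \<one>\<^bsub>F\<^esub> = \<zero>\<^bsub>F\<^esub>"
    then have two: "[(2::nat)] \<cdot>\<^bsub>F\<^esub> \<one>\<^bsub>F\<^esub> = \<zero>\<^bsub>F\<^esub>" by (simp add: numeral_2_eq_2)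
    obtain m where m: "p = 2 * m + 1" using odd by (rule oddE)
    have "[p] \<cdot>\<^bsub>F\<^esub> \<one>\<^bsub>F\<^esub> = [(2 * m)] \<cdot>\<^bsub>F\<^esub> \<one>\<^bsub>F\<^esub> \<oplus>\<^bsub>F\<^esub> [(1::nat)] \<cdot>\<^bsub>F\<^esub> \<one>\<^bsub>F\<^esub>"
      unfolding F.add.nat_pow_mult[OF F.one_closed] m ..
    then show False using p(2) F.add_pow_eq_zero[OF two, of "2 * m" "\<one>\<^bsub>F\<^esub>"] by simp
  qed
  from extension_of_degree_eight[OF \<open>field F\<close> fin this]
  obtain K :: "((('a \<times> 'a) \<times> ('a \<times> 'a)) \<times> (('a \<times> 'a) \<times> ('a \<times> 'a))) ring" and \<iota>
    where K: "extension_of_degree 8 F K \<iota>" by (elim exE conjE)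
  then interpret K: field K by (simp add: extension_of_degree_def)
  have finK: "finite (carrier K)" and cardK: "card (carrier K) = card (carrier F) ^ 8"
    and iota: "\<iota> \<in> ring_hom F K"
    using K by (simp_all add: extension_of_degree_def)
  interpret hom: ring_hom_cring F K \<iota> using iota by unfold_locales
  have "\<iota> ([k] \<cdot>\<^bsub>F\<^esub> \<one>\<^bsub>F\<^esub>) = [k] \<cdot>\<^bsub>K\<^esub> \<one>\<^bsub>K\<^esub>" for k :: nat
    by (induction k) simp_all
  from this[of p] have pK: "[p] \<cdot>\<^bsub>K\<^esub> \<one>\<^bsub>K\<^esub> = \<zero>\<^bsub>K\<^esub>" using p(2) by simp
  obtain g where g: "g \<in> carrier K" "g \<noteq> \<zero>\<^bsub>K\<^esub>"
    "\<And>x. x \<in> carrier K \<Longrightarrow> x \<noteq> \<zero>\<^bsub>K\<^esub> \<Longrightarrow> \<exists>i::nat. x = g [^]\<^bsub>K\<^esub> i"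
    using K.finite_field_generator[OF finK] by metis
  interpret fourier K g F \<iota> p n
  proof (intro fourier.intro fourier_axioms.intro field_with_generator.intro
      field_with_generator_axioms.intro finite_group_algebra.intro finite_group_algebra_axioms.intro)
    show "comm_group (integer_mod_group 32)" by simp
    show "finite (carrier (integer_mod_group 32))" by (simp add: carrier_integer_mod_group)
  qed (use K.field_axioms F.field_axioms F.is_cring finK cardK iota fin card p(1) pK odd n g in auto)
  \<comment> \<open>This turns the orbit conditions on \<open>p ^ n\<close> into conditions on the
    small number \<open>c\<close>.\<close>
  have pow: "(p ^ n) ^ t * r mod 32 = c ^ t * r mod 32" for t r :: nat
    unfolding c[symmetric] by (rule mod_mult_cong[OF power_mod[symmetric] refl])
  show ?thesis
  proof (rule iso_trans[OF units_iso_orbits H])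
    show "d dvd 8 \<and> (p ^ n) ^ d * r mod 32 = r mod 32" if "(r, d) \<in> set ds" for r d
    proof -
      have "d \<in> {1, 2, 4, 8} \<and> c ^ d * r mod 32 = r mod 32"
        using ds that by (auto simp: orbits_mod_32_def list_all_iff)
      then show ?thesis unfolding pow by auto
    qed
    show "\<exists>(r, d)\<in>set ds. \<exists>t. i = (p ^ n) ^ t * r mod 32" if "i < 32" for i
    proof -
      have "i \<in> set (concat (map (\<lambda>(r, d). map (\<lambda>t. c ^ t * r mod 32) [0..<d]) ds))"
        using ds that unfolding orbits_mod_32_def by (auto simp del: set_concat)
      then show ?thesis unfolding pow by fastforce
    qed
    show "sum_list (map snd ds) = 32" using ds by (simp add: orbits_mod_32_def)
  qed
qed

text \<open>Orbits of equal length \<open>d\<close> are listed in one block, so that their factors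
  form a single power of a cyclic group.\<close>

lemma cyclic_power_block:
  assumes "length rs = k" "c = p ^ (d * n) - 1"
  shows "product_group {..<length (map (\<lambda>r. (r, d)) rs)}
      (\<lambda>j. integer_mod_group (p ^ (snd (map (\<lambda>r. (r, d)) rs ! j) * n) - 1)) \<cong> cyclic_power c k"
proof -
  have "product_group {..<k} (\<lambda>j. integer_mod_group (p ^ (snd (map (\<lambda>r. (r, d)) rs ! j) * n) - 1))
      = cyclic_power c k"
    using assms by (intro product_group_cong) simp
  then show ?thesis using assms(1) by (simp add: iso_refl)
qed

lemma cyclic_power_block_append:
  assumes "length rs = k" "c = p ^ (d * n) - 1"
    and "product_group {..<length ys} (\<lambda>j. integer_mod_group (p ^ (snd (ys ! j) * n) - 1)) \<cong> H"
  shows "product_group {..<length (map (\<lambda>r. (r, d)) rs @ ys)}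
      (\<lambda>j. integer_mod_group (p ^ (snd ((map (\<lambda>r. (r, d)) rs @ ys) ! j) * n) - 1)) \<cong> cyclic_power c k \<times>\<times> H"
  using assms cyclic_power_split[of k "\<lambda>j. p ^ (snd ((map (\<lambda>r. (r, d)) rs @ ys) ! j) * n) - 1" c "length ys" H]
  by (simp add: nth_append)

section \<open>Orbits for the residues in the theorem\<close>

lemma upt_32: "[0..<32] = [0, 1, 2, 3, 4, 5, 6, 7, 8, 9, 10, 11, 12, 13, 14, 15, 16, 17, 18, 19, 20, 21,
    22, 23, 24, 25, 26, 27, 28, 29, 30, 31 :: nat]"
  by (simp add: upt_rec)

lemma upt_small:
  "[0..<1] = [0 :: nat]" "[0..<2] = [0, 1 :: nat]" "[0..<4] = [0, 1, 2, 3 :: nat]"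
  "[0..<8] = [0, 1, 2, 3, 4, 5, 6, 7 :: nat]"
  by (simp_all add: upt_rec)

text \<open>The orbits depend only on the subgroup generated by \<open>c\<close>. Each of 3, 11, 19,
  27 generates the group of residues that are 1 or 3 modulo 8, and each of 5, 13, 21, 29 the group
  of residues that are 1 modulo 4; hence one list serves four residues. The blocks are ordered like
  the factors in the theorem.\<close>

lemma orbits:
  "c \<in> {1} \<Longrightarrow> orbits_mod_32 c (map (\<lambda>r. (r, 1)) [0..<32])"
  "c \<in> {31} \<Longrightarrow> orbits_mod_32 c (map (\<lambda>r. (r, 1)) [0, 16] @ map (\<lambda>r. (r, 2)) [1, 2, 3, 4, 5, 6, 7, 8, 9, 10, 11, 12, 13, 14, 15])"
  "c \<in> {3, 27, 11, 19} \<Longrightarrow> orbits_mod_32 c (map (\<lambda>r. (r, 8)) [1, 5] @ map (\<lambda>r. (r, 4)) [2, 10]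
    @ map (\<lambda>r. (r, 2)) [4, 8, 20] @ map (\<lambda>r. (r, 1)) [0, 16])"
  "c \<in> {29, 5, 21, 13} \<Longrightarrow> orbits_mod_32 c (map (\<lambda>r. (r, 8)) [1, 3] @ map (\<lambda>r. (r, 4)) [2, 6]
    @ map (\<lambda>r. (r, 2)) [4, 12] @ map (\<lambda>r. (r, 1)) [0, 8, 16, 24])"
  "c \<in> {7} \<Longrightarrow> orbits_mod_32 c (map (\<lambda>r. (r, 1)) [0, 16] @ map (\<lambda>r. (r, 4)) [1, 3, 9, 11]
    @ map (\<lambda>r. (r, 2)) [2, 4, 6, 8, 12, 18, 22])"
  "c \<in> {25} \<Longrightarrow> orbits_mod_32 c (map (\<lambda>r. (r, 1)) [0, 4, 8, 12, 16, 20, 24, 28]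
    @ map (\<lambda>r. (r, 2)) [2, 6, 10, 14] @ map (\<lambda>r. (r, 4)) [1, 3, 5, 7])"
  "c \<in> {15} \<Longrightarrow> orbits_mod_32 c (map (\<lambda>r. (r, 1)) [0, 16]
    @ map (\<lambda>r. (r, 2)) [2, 4, 6, 8, 10, 12, 14, 1, 3, 5, 7, 17, 19, 21, 23])"
  "c \<in> {17} \<Longrightarrow> orbits_mod_32 c (map (\<lambda>r. (r, 1)) [0, 2, 4, 6, 8, 10, 12, 14, 16, 18, 20, 22, 24, 26, 28, 30]
    @ map (\<lambda>r. (r, 2)) [1, 3, 5, 7, 9, 11, 13, 15])"
  unfolding orbits_mod_32_def upt_32
  by ((elim insertE emptyE; simp add: upt_small del: One_nat_def)+)

text \<open>A prime is not zero, so the default value 0 is excluded and \<open>p\<close> is the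
  least element of a nonempty set.\<close>

lemma ring_characteristic_prime:
  assumes "ring_characteristic R = p" "Factorial_Ring.prime p"
  shows "[p] \<cdot>\<^bsub>R\<^esub> \<one>\<^bsub>R\<^esub> = \<zero>\<^bsub>R\<^esub>"
proof -
  let ?P = "\<lambda>k::nat. k > 0 \<and> [k] \<cdot>\<^bsub>R\<^esub> \<one>\<^bsub>R\<^esub> = \<zero>\<^bsub>R\<^esub>"
  have ex: "\<exists>k. ?P k" and p: "p = (LEAST k. ?P k)"
    using assms by (auto simp: ring_characteristic_def split: if_splits)
  show ?thesis unfolding p using LeastI_ex[OF ex] by simp
qed

text \<open>On the integers \<open>mod 32\<close> takes values in \<open>{0..<32}\<close>, so a
  negative \<open>k\<close> such as -5 becomes 27.\<close>

lemma int_cong_imp_mod: "[int q = k] (mod 32) \<Longrightarrow> q mod 32 = nat (k mod 32)"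
  unfolding cong_def by (metis nat_int of_nat_mod of_nat_numeral)

theorem theorem3p1:
  fixes F :: "('a, 'm) ring_scheme" and p n :: nat
  assumes "Factorial_Ring.prime p" and "n \<ge> 1"
    and "field F" and "finite (carrier F)" and "ring_characteristic F = p" and "card (carrier F) = p ^ n"
  shows "(p = 2 \<longrightarrow>
      units_of (group_algebra F (integer_mod_group 32))
        \<cong> cyclic_power 32 n \<times>\<times> cyclic_power 16 n \<times>\<times> cyclic_power 8 (2 * n) \<times>\<times> cyclic_power 4 (4 * n) \<times>\<times> cyclic_power 2 (8 * n) \<times>\<times> integer_mod_group (2 ^ n - 1)) \<and>
    (p \<noteq> 2 \<longrightarrow>
      ([int (p ^ n) = 1] (mod 32) \<longrightarrow>
        units_of (group_algebra F (integer_mod_group 32))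
          \<cong> cyclic_power (p ^ n - 1) 32) \<and>
      ([int (p ^ n) = - 1] (mod 32) \<longrightarrow>
        units_of (group_algebra F (integer_mod_group 32))
          \<cong> cyclic_power (p ^ n - 1) 2 \<times>\<times> cyclic_power (p ^ (2 * n) - 1) 15) \<and>
      (([int (p ^ n) = 3] (mod 32) \<or> [int (p ^ n) = - 5] (mod 32) \<or>
         [int (p ^ n) = 11] (mod 32) \<or> [int (p ^ n) = - 13] (mod 32)) \<longrightarrow>
        units_of (group_algebra F (integer_mod_group 32))
          \<cong> cyclic_power (p ^ (8 * n) - 1) 2 \<times>\<times> cyclic_power (p ^ (4 * n) - 1) 2 \<times>\<times> cyclic_power (p ^ (2 * n) - 1) 3 \<times>\<times> cyclic_power (p ^ n - 1) 2) \<and>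
      (([int (p ^ n) = - 3] (mod 32) \<or> [int (p ^ n) = 5] (mod 32) \<or>
         [int (p ^ n) = - 11] (mod 32) \<or> [int (p ^ n) = 13] (mod 32)) \<longrightarrow>
        units_of (group_algebra F (integer_mod_group 32))
          \<cong> cyclic_power (p ^ (8 * n) - 1) 2 \<times>\<times> cyclic_power (p ^ (4 * n) - 1) 2 \<times>\<times> cyclic_power (p ^ (2 * n) - 1) 2 \<times>\<times> cyclic_power (p ^ n - 1) 4) \<and>
      ([int (p ^ n) = 7] (mod 32) \<longrightarrow>
        units_of (group_algebra F (integer_mod_group 32))
          \<cong> cyclic_power (p ^ n - 1) 2 \<times>\<times> cyclic_power (p ^ (4 * n) - 1) 4 \<times>\<times> cyclic_power (p ^ (2 * n) - 1) 7) \<and>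
      ([int (p ^ n) = - 7] (mod 32) \<longrightarrow>
        units_of (group_algebra F (integer_mod_group 32))
          \<cong> cyclic_power (p ^ n - 1) 8 \<times>\<times> cyclic_power (p ^ (2 * n) - 1) 4 \<times>\<times> cyclic_power (p ^ (4 * n) - 1) 4) \<and>
      ([int (p ^ n) = 15] (mod 32) \<longrightarrow>
        units_of (group_algebra F (integer_mod_group 32))
          \<cong> cyclic_power (p ^ n - 1) 2 \<times>\<times> cyclic_power (p ^ (2 * n) - 1) 15) \<and>
      ([int (p ^ n) = - 15] (mod 32) \<longrightarrow>
        units_of (group_algebra F (integer_mod_group 32))
          \<cong> cyclic_power (p ^ n - 1) 16 \<times>\<times> cyclic_power (p ^ (2 * n) - 1) 8))"
proof -
  interpret F: field F by fact
  have n: "n > 0" using assms(2) by simp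
  have p0: "[p] \<cdot>\<^bsub>F\<^esub> \<one>\<^bsub>F\<^esub> = \<zero>\<^bsub>F\<^esub>"
    using assms(1,5) by (rule ring_characteristic_prime[rotated])
  let ?U = "units_of (group_algebra F (integer_mod_group 32))"
  have two: ?thesis if "p = 2"
    using units_group_algebra_char_two[OF assms(3,4) _ _ n] p0 assms(6) that by simp
  have odd: ?thesis if p2: "p \<noteq> 2"
  proof -
    have "odd p" using assms(1) p2 prime_odd_nat[of p] prime_gt_1_nat[of p] by simp
    \<comment> \<open>\<open>refl\<close> instantiates \<open>c\<close> to the actual residue
      \<open>p ^ n mod 32\<close>; each case then only has to know in which set of residues it
      lies.\<close>
    note iso = units_group_algebra_odd[OF assms(3,4,1) p0 \<open>odd p\<close> assms(6) n refl]
    let ?r = "p ^ n mod 32"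
    have 1: "?U \<cong> cyclic_power (p ^ n - 1) 32" if "?r \<in> {1}"
      by (rule iso[OF orbits(1)[OF that] cyclic_power_block]) simp_all
    have 2: "?U \<cong> cyclic_power (p ^ n - 1) 2 \<times>\<times> cyclic_power (p ^ (2 * n) - 1) 15" if "?r \<in> {31}"
      by (rule iso[OF orbits(2)[OF that] cyclic_power_block_append[OF _ _ cyclic_power_block]]) simp_all
    have 3: "?U \<cong> cyclic_power (p ^ (8 * n) - 1) 2 \<times>\<times> cyclic_power (p ^ (4 * n) - 1) 2
        \<times>\<times> cyclic_power (p ^ (2 * n) - 1) 3 \<times>\<times> cyclic_power (p ^ n - 1) 2" if "?r \<in> {3, 27, 11, 19}"
      by (rule iso[OF orbits(3)[OF that] cyclic_power_block_append[OF _ _ cyclic_power_block_append[OF _ _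
            cyclic_power_block_append[OF _ _ cyclic_power_block]]]]) simp_all
    have 4: "?U \<cong> cyclic_power (p ^ (8 * n) - 1) 2 \<times>\<times> cyclic_power (p ^ (4 * n) - 1) 2
        \<times>\<times> cyclic_power (p ^ (2 * n) - 1) 2 \<times>\<times> cyclic_power (p ^ n - 1) 4" if "?r \<in> {29, 5, 21, 13}"
      by (rule iso[OF orbits(4)[OF that] cyclic_power_block_append[OF _ _ cyclic_power_block_append[OF _ _
            cyclic_power_block_append[OF _ _ cyclic_power_block]]]]) simp_all
    have 5: "?U \<cong> cyclic_power (p ^ n - 1) 2 \<times>\<times> cyclic_power (p ^ (4 * n) - 1) 4
        \<times>\<times> cyclic_power (p ^ (2 * n) - 1) 7" if "?r \<in> {7}"
      by (rule iso[OF orbits(5)[OF that] cyclic_power_block_append[OF _ _ cyclic_power_block_append[OF _ _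
            cyclic_power_block]]]) simp_all
    have 6: "?U \<cong> cyclic_power (p ^ n - 1) 8 \<times>\<times> cyclic_power (p ^ (2 * n) - 1) 4
        \<times>\<times> cyclic_power (p ^ (4 * n) - 1) 4" if "?r \<in> {25}"
      by (rule iso[OF orbits(6)[OF that] cyclic_power_block_append[OF _ _ cyclic_power_block_append[OF _ _
            cyclic_power_block]]]) simp_all
    have 7: "?U \<cong> cyclic_power (p ^ n - 1) 2 \<times>\<times> cyclic_power (p ^ (2 * n) - 1) 15" if "?r \<in> {15}"
      by (rule iso[OF orbits(7)[OF that] cyclic_power_block_append[OF _ _ cyclic_power_block]]) simp_all
    have 8: "?U \<cong> cyclic_power (p ^ n - 1) 16 \<times>\<times> cyclic_power (p ^ (2 * n) - 1) 8" if "?r \<in> {17}"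
      by (rule iso[OF orbits(8)[OF that] cyclic_power_block_append[OF _ _ cyclic_power_block]]) simp_all
    note residue = int_cong_imp_mod[of "p ^ n"]
    show ?thesis
    proof (intro conjI impI)
      assume "[int (p ^ n) = 1] (mod 32)"
      then show "?U \<cong> cyclic_power (p ^ n - 1) 32"
        by (intro 1) (simp add: residue del: of_nat_power)
    next
      assume "[int (p ^ n) = - 1] (mod 32)"
      then show "?U \<cong> cyclic_power (p ^ n - 1) 2 \<times>\<times> cyclic_power (p ^ (2 * n) - 1) 15"
        by (intro 2) (simp add: residue del: of_nat_power)
    next
      assume "[int (p ^ n) = 3] (mod 32) \<or> [int (p ^ n) = - 5] (mod 32) \<or>
        [int (p ^ n) = 11] (mod 32) \<or> [int (p ^ n) = - 13] (mod 32)"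
      then show "?U \<cong> cyclic_power (p ^ (8 * n) - 1) 2 \<times>\<times> cyclic_power (p ^ (4 * n) - 1) 2
        \<times>\<times> cyclic_power (p ^ (2 * n) - 1) 3 \<times>\<times> cyclic_power (p ^ n - 1) 2"
        by (intro 3) (elim disjE; simp add: residue del: of_nat_power)
    next
      assume "[int (p ^ n) = - 3] (mod 32) \<or> [int (p ^ n) = 5] (mod 32) \<or>
        [int (p ^ n) = - 11] (mod 32) \<or> [int (p ^ n) = 13] (mod 32)"
      then show "?U \<cong> cyclic_power (p ^ (8 * n) - 1) 2 \<times>\<times> cyclic_power (p ^ (4 * n) - 1) 2
        \<times>\<times> cyclic_power (p ^ (2 * n) - 1) 2 \<times>\<times> cyclic_power (p ^ n - 1) 4"
        by (intro 4) (elim disjE; simp add: residue del: of_nat_power)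
    next
      assume "[int (p ^ n) = 7] (mod 32)"
      then show "?U \<cong> cyclic_power (p ^ n - 1) 2 \<times>\<times> cyclic_power (p ^ (4 * n) - 1) 4
        \<times>\<times> cyclic_power (p ^ (2 * n) - 1) 7"
        by (intro 5) (simp add: residue del: of_nat_power)
    next
      assume "[int (p ^ n) = - 7] (mod 32)"
      then show "?U \<cong> cyclic_power (p ^ n - 1) 8 \<times>\<times> cyclic_power (p ^ (2 * n) - 1) 4
        \<times>\<times> cyclic_power (p ^ (4 * n) - 1) 4"
        by (intro 6) (simp add: residue del: of_nat_power)
    next
      assume "[int (p ^ n) = 15] (mod 32)"
      then show "?U \<cong> cyclic_power (p ^ n - 1) 2 \<times>\<times> cyclic_power (p ^ (2 * n) - 1) 15"
        by (intro 7) (simp add: residue del: of_nat_power)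
    next
      assume "[int (p ^ n) = - 15] (mod 32)"
      then show "?U \<cong> cyclic_power (p ^ n - 1) 16 \<times>\<times> cyclic_power (p ^ (2 * n) - 1) 8"
        by (intro 8) (simp add: residue del: of_nat_power)
    \<comment> \<open>What remains is the claim for \<open>p = 2\<close>, which contradicts
      \<open>p2\<close>.\<close>
    qed (simp add: p2)
  qed
  show ?thesis using two odd by blast
qed

end
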